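(* Let $k\ge 1$ and let $\Psi_0\colon\mathbb R^k\to\operatorname{SO}(9)$ be any Lie group homomorphism. Let $\mathcal G$ be the octonionic Hopf fibration $S^7\hookrightarrow S^{15}\to S^8$, extended radially to the foliation of $\mathbb R^{16}$ with leaves $\{0\}$ and $r\cdot A$ ($r>0$, $A$ a fibre), and let $\operatorname{SO}(9)=\operatorname{Spin}(9)/\{\pm1\}$ act on the set of leaves of this foliation. For $x\in\mathbb R^{16}$ let $\mathcal G_x$ be the leaf through $x$. Then the sets $$F_x=\{(v,y)\in\mathbb R^k\times\mathbb R^{16}\mid v\in\mathbb R^k,\ y\in\Psi_0(v).\mathcal G_x\},\qquad x\in\mathbb R^{16},$$ are the leaves of an inhomogeneous non-compact equidistant foliation of $\mathbb R^{k+16}$, whose induced foliation (i.e. the foliation of each layer $\{v\}\times\mathbb R^{16}$ by intersections with the leaves) is given by the Hopf fibration $S^7\hookrightarrow S^{15}\to S^8$.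
   Context: An equidistant foliation of $\mathbb R^m$ is a partition $\mathcal F$ of $\mathbb R^m$ into complete, smooth, connected, properly embedded submanifolds (leaves, possibly of different dimensions) such that for any two leaves $F,G\in\mathcal F$ and $p\in F$ the distance $\operatorname{dist}(p,G)$ does not depend on the choice of $p\in F$, and such that any vector tangent to a leaf can be locally extended to a smooth vector field everywhere tangent to the leaves. It is homogeneous if its leaves are the orbits of a Lie group acting by isometries, inhomogeneous otherwise; non-compact means that the leaves are non-compact. The octonionic Hopf fibration is the Riemannian submersion with totally geodesic fibres isometric to $S^7$ from the round unit sphere $S^{15}=\operatorname{Spin}(9)/\widetilde{\operatorname{Spin}(7)}$ to $S^8=\operatorname{Spin}(9)/\operatorname{Spin}(8)$ (a round sphere of radius $1/2$), $g\widetilde{\operatorname{Spin}(7)}\mapsto g\operatorname{Spin}(8)$, where $\widetilde{\operatorname{Spin}(7)}$ is the image of the standard $\operatorname{Spin}(7)\subset\operatorname{Spin}(8)$ under a non-trivial triality automorphism of $\operatorname{Spin}(8)$. Here $\operatorname{Spin}(9)\subset\operatorname{SO}(16)$ acts on $\mathbb R^{16}$ by the spin representation, permuting the fibres; $-1\in\operatorname{Spin}(9)$ acts as $-\mathrm{id}$ on $\mathbb R^{16}$ and maps every fibre to itself, so $\operatorname{SO}(9)=\operatorname{Spin}(9)/\{\pm1\}$ acts on the set of fibres (and, extended radially, on the set of leaves in $\mathbb R^{16}$). *)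

theory Defs
  imports "HOL-Analysis.Analysis" "HOL-Algebra.Group_Action"
begin

section \<open>Smooth maps and submanifolds of Euclidean space\<close>

text \<open>For open \<open>S\<close> in a finite-dimensional space, \<open>Ck_on n S f\<close> says that \<open>f\<close> is of class
  \<open>C\<^sup>n\<close> on \<open>S\<close>.\<close>

primrec Ck_on :: "nat \<Rightarrow> 'a::real_normed_vector set \<Rightarrow> ('a \<Rightarrow> 'b::real_normed_vector) \<Rightarrow> bool"
  where
    "Ck_on 0 S f \<longleftrightarrow> continuous_on S f"
  | "Ck_on (Suc n) S f \<longleftrightarrow>
       (\<forall>x\<in>S. f differentiable (at x)) \<and> (\<forall>v. Ck_on n S (\<lambda>x. frechet_derivative f (at x) v))"

text \<open>On an arbitrary set, smooth means: locally the restriction of a \<open>C\<^sup>\<infinity>\<close> map defined on an open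
  set of the ambient space. For embedded submanifolds this is intrinsic smoothness.\<close>

definition smooth_on :: "'a::real_normed_vector set \<Rightarrow> ('a \<Rightarrow> 'b::real_normed_vector) \<Rightarrow> bool"
  where "smooth_on S f \<longleftrightarrow>
    (\<forall>x\<in>S. \<exists>U h. open U \<and> x \<in> U \<and> (\<forall>n. Ck_on n U h) \<and> (\<forall>y\<in>U \<inter> S. h y = f y))"

definition embedded_submanifold :: "nat \<Rightarrow> 'a::euclidean_space set \<Rightarrow> bool"
  where "embedded_submanifold d S \<longleftrightarrow>
    (\<forall>p\<in>S. \<exists>U V E \<phi> \<psi>. open U \<and> p \<in> U \<and> open V \<and> subspace (E :: 'a set) \<and> dim E = d \<and>
       homeomorphism U V \<phi> \<psi> \<and> smooth_on U \<phi> \<and> smooth_on V \<psi> \<and> \<phi> ` (U \<inter> S) = V \<inter> E)"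

definition properly_embedded :: "'a::euclidean_space set \<Rightarrow> bool"
  where "properly_embedded S \<longleftrightarrow> (\<forall>K. compact K \<longrightarrow> compact (S \<inter> K))"

definition tangent_vectors :: "'a::euclidean_space set \<Rightarrow> 'a \<Rightarrow> 'a set"
  where "tangent_vectors S p =
    {v. \<exists>\<epsilon>>0. \<exists>c. c 0 = p \<and> c ` {-\<epsilon><..<\<epsilon>} \<subseteq> S \<and> smooth_on {-\<epsilon><..<\<epsilon>} c \<and>
          (c has_vector_derivative v) (at (0::real))}"

text \<open>Lengths are taken with the Lebesgue integral in \<^typ>\<open>ennreal\<close> because the derivative of a
  \<^const>\<open>valid_path\<close> may be unbounded near the exceptional points; such a path can have infinite
  length.\<close>

definition curve_length :: "(real \<Rightarrow> 'a::euclidean_space) \<Rightarrow> ennreal"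
  where "curve_length c = (\<integral>\<^sup>+t\<in>{0..1}. ennreal (norm (vector_derivative c (at t))) \<partial>lborel)"

definition intrinsic_dist :: "'a::euclidean_space set \<Rightarrow> 'a \<Rightarrow> 'a \<Rightarrow> ennreal"
  where "intrinsic_dist S x y =
    (INF c\<in>{c. valid_path c \<and> path_image c \<subseteq> S \<and> pathstart c = x \<and> pathfinish c = y}.
       curve_length c)"

definition complete_submanifold :: "'a::euclidean_space set \<Rightarrow> bool"
  where "complete_submanifold S \<longleftrightarrow>
    (\<forall>X. (\<forall>n. X n \<in> S) \<and> (\<forall>e>0. \<exists>N. \<forall>m\<ge>N. \<forall>n\<ge>N. intrinsic_dist S (X m) (X n) < e) \<longrightarrow>
       (\<exists>p\<in>S. (\<lambda>n. intrinsic_dist S (X n) p) \<longlonglongrightarrow> 0))"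


section \<open>Equidistant foliations\<close>

definition equidistant_foliation :: "'a::euclidean_space set set \<Rightarrow> bool"
  where "equidistant_foliation \<F> \<longleftrightarrow>
    partition_on UNIV \<F> \<and>
    (\<forall>L\<in>\<F>. (\<exists>d. embedded_submanifold d L) \<and> complete_submanifold L \<and> connected L \<and>
       properly_embedded L) \<and>
    (\<forall>F\<in>\<F>. \<forall>G\<in>\<F>. \<forall>p\<in>F. \<forall>q\<in>F. infdist p G = infdist q G) \<and>
    (\<forall>F\<in>\<F>. \<forall>p\<in>F. \<forall>v\<in>tangent_vectors F p.
       \<exists>U X. open U \<and> p \<in> U \<and> smooth_on U X \<and> X p = v \<and>
         (\<forall>L\<in>\<F>. \<forall>q\<in>U \<inter> L. X q \<in> tangent_vectors L q))"

definition noncompact_foliation :: "'a::euclidean_space set set \<Rightarrow> bool"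
  where "noncompact_foliation \<F> \<longleftrightarrow> (\<forall>L\<in>\<F>. \<not> compact L)"

text \<open>Lie groups are presented as embedded submanifolds of a Euclidean space; by the Whitney
  embedding theorem every (second countable) Lie group has such a presentation.\<close>

definition lie_group :: "('g::euclidean_space) monoid \<Rightarrow> bool"
  where "lie_group G \<longleftrightarrow>
    group G \<and> (\<exists>d. embedded_submanifold d (carrier G)) \<and>
    smooth_on (carrier G \<times> carrier G) (\<lambda>(a, b). a \<otimes>\<^bsub>G\<^esub> b) \<and>
    smooth_on (carrier G) (\<lambda>a. inv\<^bsub>G\<^esub> a)"

definition lie_group_hom ::
  "('g::euclidean_space) monoid \<Rightarrow> ('h::euclidean_space) monoid \<Rightarrow> ('g \<Rightarrow> 'h) \<Rightarrow> bool"
  where "lie_group_hom G H f \<longleftrightarrow> f \<in> hom G H \<and> smooth_on (carrier G) f"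

text \<open>The type argument is the Euclidean space in which the acting Lie group is embedded. A foliation
  is homogeneous if this holds for some \<^typ>\<open>'g\<close>, and inhomogeneous if it fails for all \<^typ>\<open>'g\<close>;
  a theorem asserting the negation with \<^typ>\<open>'g\<close> schematic says the latter.\<close>

definition homogeneous_foliation :: "'g::euclidean_space itself \<Rightarrow> 'a::euclidean_space set set \<Rightarrow> bool"
  where "homogeneous_foliation (_ :: 'g itself) \<F> \<longleftrightarrow>
    (\<exists>(G :: 'g monoid) \<phi>. lie_group G \<and> group_action G UNIV \<phi> \<and>
       smooth_on (carrier G \<times> UNIV) (\<lambda>(g, x). \<phi> g x) \<and>
       (\<forall>g\<in>carrier G. \<forall>x y. dist (\<phi> g x) (\<phi> g y) = dist x y) \<and>
       \<F> = orbits G UNIV \<phi>)"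

definition induced_foliation :: "('a \<times> 'b) set set \<Rightarrow> 'a \<Rightarrow> 'b set set"
  where "induced_foliation \<F> v = (\<lambda>F. {y. (v, y) \<in> F}) ` \<F>"


section \<open>Octonions and the spin representation of Spin(9)\<close>

text \<open>Cayley--Dickson doubling. The product types carry the standard Euclidean norm, so
  \<open>octonion\<close> is \<open>\<real>\<^sup>8\<close> and \<open>octonion \<times> octonion\<close> is \<open>\<real>\<^sup>1\<^sup>6\<close>.\<close>

type_synonym quaternion = "complex \<times> complex"
type_synonym octonion = "quaternion \<times> quaternion"

fun quat_cnj :: "quaternion \<Rightarrow> quaternion"
  where "quat_cnj (a, b) = (cnj a, - b)"

fun quat_mult :: "quaternion \<Rightarrow> quaternion \<Rightarrow> quaternion"
  where "quat_mult (a, b) (c, d) = (a * c - cnj d * b, d * a + b * cnj c)"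

fun oct_cnj :: "octonion \<Rightarrow> octonion"
  where "oct_cnj (p, q) = (quat_cnj p, - q)"

fun oct_mult :: "octonion \<Rightarrow> octonion \<Rightarrow> octonion"
  where "oct_mult (p, q) (r, s) =
    (quat_mult p r - quat_mult (quat_cnj s) q, quat_mult s p + quat_mult q (quat_cnj r))"

abbreviation oct_one :: octonion
  where "oct_one \<equiv> ((1, 0), (0, 0))"

definition oct_part :: "real ^ 9 \<Rightarrow> octonion"
  where "oct_part v =
    ((Complex (v $ 2) (v $ 3), Complex (v $ 4) (v $ 5)),
     (Complex (v $ 6) (v $ 7), Complex (v $ 8) (v $ 9)))"

text \<open>Clifford multiplication of \<open>\<real>\<^sup>9 = \<real> \<oplus> \<O>\<close> on \<open>\<real>\<^sup>1\<^sup>6 = \<O> \<oplus> \<O>\<close>; one has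
  \<open>clifford v (clifford v x) = (norm v)\<^sup>2 *\<^sub>R x\<close>.\<close>

fun clifford :: "real ^ 9 \<Rightarrow> octonion \<times> octonion \<Rightarrow> octonion \<times> octonion"
  where "clifford v (x, y) =
    ((v $ 1) *\<^sub>R x + oct_mult (oct_part v) y, oct_mult (oct_cnj (oct_part v)) x - (v $ 1) *\<^sub>R y)"

text \<open>The spin group of a subspace \<open>V\<close> of \<open>\<real>\<^sup>9\<close> (products of an even number of unit vectors of \<open>V\<close> in
  the Clifford algebra), as a group of linear maps of \<open>\<real>\<^sup>1\<^sup>6\<close>.\<close>

inductive_set spin_group :: "(real ^ 9) set \<Rightarrow> (octonion \<times> octonion \<Rightarrow> octonion \<times> octonion) set"
  for V
  where
    id: "id \<in> spin_group V"
  | mult: "g \<in> spin_group V \<Longrightarrow> u \<in> V \<Longrightarrow> w \<in> V \<Longrightarrow> norm u = 1 \<Longrightarrow> norm w = 1 \<Longrightarrow>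
      clifford u \<circ> clifford w \<circ> g \<in> spin_group V"

definition Spin9 :: "(octonion \<times> octonion \<Rightarrow> octonion \<times> octonion) set"
  where "Spin9 = spin_group UNIV"

definition Spin8 :: "(octonion \<times> octonion \<Rightarrow> octonion \<times> octonion) set"
  where "Spin8 = spin_group {v. v $ 1 = 0}"

text \<open>The covering homomorphism from Spin(9) to SO(9), with kernel \<open>{id, - id}\<close>, as a relation:
  \<open>g\<close> lies over \<open>A\<close> iff \<open>g \<circ> clifford v \<circ> g\<^sup>-\<^sup>1 = clifford (A v)\<close> for all \<open>v\<close>.\<close>

definition spin_lift_of ::
  "(octonion \<times> octonion \<Rightarrow> octonion \<times> octonion) \<Rightarrow> real ^ 9 ^ 9 \<Rightarrow> bool"
  where "spin_lift_of g A \<longleftrightarrow> g \<in> Spin9 \<and> (\<forall>v. g \<circ> clifford v = clifford (A *v v) \<circ> g)"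

definition SO9 :: "(real ^ 9 ^ 9) monoid"
  where "SO9 = \<lparr>carrier = {A. rotation_matrix A}, mult = (**), one = mat 1\<rparr>"

definition vector_group :: "('a::euclidean_space) monoid"
  where "vector_group = \<lparr>carrier = UNIV, mult = (+), one = 0\<rparr>"


section \<open>The octonionic Hopf fibration\<close>

text \<open>The isotropy group in Spin(9) of the unit vector \<open>(1, 0)\<close> is the group of those elements of
  Spin(8) that fix a unit half-spinor, that is, the image of the standard Spin(7), the stabiliser
  of a unit vector of \<open>\<real>\<^sup>8\<close>, under a non-trivial triality automorphism. So the orbit map
  \<open>g \<mapsto> g (1, 0)\<close> identifies the quotient of Spin(9) by this group with the unit sphere of \<open>\<real>\<^sup>1\<^sup>6\<close>,
  and the fibre over \<open>g\<close> Spin(8) becomes the image of the coset \<open>g\<close> Spin(8) under the orbit map.\<close>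

definition hopf_base :: "octonion \<times> octonion"
  where "hopf_base = (oct_one, 0)"

definition hopf_fibre :: "(octonion \<times> octonion \<Rightarrow> octonion \<times> octonion) \<Rightarrow> (octonion \<times> octonion) set"
  where "hopf_fibre g = {(g \<circ> h) hopf_base | h. h \<in> Spin8}"

definition hopf_foliation :: "(octonion \<times> octonion) set set"
  where "hopf_foliation =
    insert {0} {(\<lambda>x. r *\<^sub>R x) ` hopf_fibre g | r g. r > 0 \<and> g \<in> Spin9}"

definition leaf_through :: "'a set set \<Rightarrow> 'a \<Rightarrow> 'a set"
  where "leaf_through \<F> x = (THE L. L \<in> \<F> \<and> x \<in> L)"

text \<open>An element of SO(9) is a coset \<open>{g, - g}\<close> in Spin(9); both representatives map a leaf onto the
  same leaf, so the union over the coset is the image under either one.\<close>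

definition SO9_act :: "real ^ 9 ^ 9 \<Rightarrow> (octonion \<times> octonion) set \<Rightarrow> (octonion \<times> octonion) set"
  where "SO9_act A L = {g y | g y. spin_lift_of g A \<and> y \<in> L}"

definition twisted_leaf ::
  "(real ^ 'k \<Rightarrow> real ^ 9 ^ 9) \<Rightarrow> octonion \<times> octonion \<Rightarrow> ((real ^ 'k) \<times> (octonion \<times> octonion)) set"
  where "twisted_leaf \<Psi> x = {(v, y). y \<in> SO9_act (\<Psi> v) (leaf_through hopf_foliation x)}"

end

theory Submission
  imports Defs
begin

text \<open>
  Everything is governed by one quadratic map. Clifford multiplication makes every \<open>v \<in> \<real>\<^sup>9\<close> a
  symmetric operator on \<open>\<real>\<^sup>1\<^sup>6\<close> with square \<open>\<bar>v\<bar>\<^sup>2\<close>, and the Hopf map \<open>h : \<real>\<^sup>1\<^sup>6 \<rightarrow> \<real>\<^sup>9\<close> is defined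
  by \<open>\<langle>h s, v\<rangle> = \<langle>s, v s\<rangle>\<close>. Multiplicativity of the octonion norm gives \<open>\<bar>h s\<bar> = \<bar>s\<bar>\<^sup>2\<close>
  (\<open>norm_hopf_map\<close>), so equality in the Cauchy--Schwarz inequality turns \<open>h s = w\<close> into the eigenvalue
  equation \<open>w s = \<bar>w\<bar> s\<close> together with \<open>\<bar>s\<bar>\<^sup>2 = \<bar>w\<bar>\<close> (\<open>hopf_map_eq_iff\<close>). The map \<open>h\<close> is equivariant
  for the covering of \<open>SO(9)\<close> by \<open>Spin(9)\<close>, the covering is onto because a rotation is a product of an
  even number of reflections, and the leaves of the Hopf foliation are exactly the fibres of \<open>h\<close>
  (\<open>hopf_foliation_eq\<close>). Hence the twisted leaves are the fibres of
  \<open>H(v, s) = \<Psi>(v)\<^sup>T h(s)\<close>, a map that is smooth, onto, and a submersion off \<open>s = 0\<close>.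

  The local structure of the leaves comes from an explicit trivialisation. For a unit spinor \<open>c\<close> put \<open>e = h c\<close>. A spinor \<open>s\<close> with \<open>\<langle>s, c\<rangle> > 0\<close> is determined by \<open>h s\<close> and the direction of
  its component in the \<open>+1\<close> eigenspace of \<open>e\<close>, and it is recovered as a multiple of
  \<open>(\<bar>w\<bar> + w) \<eta>\<close> with \<open>w = h s\<close> and \<open>\<eta>\<close> in that eigenspace. This gives one formula for charts in which \<open>H\<close>
  becomes linear, so that all leaves through the chart become parallel affine subspaces at once
  (\<open>chart\<close>, \<open>chart_inv\<close>). They provide the submanifold structure, the
  local vector fields tangent to the leaves, and, since leaves are closed, completeness
  (\<open>closed_embedded_imp_complete\<close>). At the singular leaf \<open>s = 0\<close> the vector field
  is \<open>(\<xi>, \<beta> s)\<close>, where \<open>\<beta>\<close> lies in the spin Lie algebra over the derivative of \<open>\<Psi>\<close> in the direction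
  \<open>\<xi>\<close> (\<open>tangent_field_singular\<close>).

  For equidistance, the maximum of \<open>\<langle>s, s'\<rangle>\<close> over the fibre of \<open>s'\<close> depends on \<open>s\<close> only through \<open>h s\<close>
  (\<open>hopf_fibre_transport\<close>); the layers are compared by a translation of \<open>\<real>\<^sup>k\<close> combined with a spin lift of the
  corresponding value of \<open>\<Psi>\<close>, which preserves \<open>H\<close> because \<open>\<Psi>\<close> is a homomorphism of an abelian group.

  For inhomogeneity, suppose a group of isometries had the leaves as orbits. Some element moves
  \<open>(0, (1, 0))\<close> to \<open>(0, (l, 0))\<close> for an octonion unit \<open>l\<close> orthogonal to a quaternion subalgebra. It
  fixes the origin, so it is linear, preserves the splitting \<open>\<real>\<^sup>k \<oplus> \<real>\<^sup>1\<^sup>6\<close>, and acts on \<open>\<real>\<^sup>1\<^sup>6\<close> by a linear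
  isometry \<open>L\<close> with \<open>h \<circ> L = h\<close>. Such an \<open>L\<close> commutes with all Clifford multiplications
  (\<open>hopf_isometry_commutes_clifford\<close>), hence with all left multiplications of octonions on the first factor, which forces
  \<open>(p q) l = p (q l)\<close> for all \<open>p, q\<close>; the octonions are not associative.
\<close>

section \<open>Calculus of \<open>C\<^sup>n\<close> maps\<close>

lemma Ck_on_subset: "Ck_on n S f \<Longrightarrow> T \<subseteq> S \<Longrightarrow> Ck_on n T f"
  by (induction n arbitrary: f) (auto intro: continuous_on_subset)

text \<open>On an open set the derivatives at a point depend only on nearby values, which makes \<^const>\<open>Ck_on\<close>
  insensitive to changes off the set.\<close>
lemma Ck_on_cong:
  assumes "open S" "\<And>x. x \<in> S \<Longrightarrow> f x = g x" "Ck_on n S f"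
  shows "Ck_on n S g"
  using assms(2,3)
proof (induction n arbitrary: f g)
  case 0
  then show ?case using continuous_on_cong[of S S f g] by simp
next
  case (Suc n)
  have der: "(g has_derivative frechet_derivative f (at x)) (at x)" if "x \<in> S" for x
    using has_derivative_transform_within_open[of f _ x UNIV S g] Suc.prems that assms(1)
    by (auto simp: frechet_derivative_works)
  then have "g differentiable at x" "frechet_derivative g (at x) = frechet_derivative f (at x)"
    if "x \<in> S" for x
    using that by (auto simp: differentiable_def frechet_derivative_at[symmetric])
  moreover have "Ck_on n S (\<lambda>x. frechet_derivative g (at x) v)" for v
    by (rule Suc.IH[of "\<lambda>x. frechet_derivative f (at x) v"]) (use Suc.prems calculation in auto)
  ultimately show ?case by simp
qed

lemma Ck_on_continuous_on: "Ck_on n S f \<Longrightarrow> continuous_on S f"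
  by (cases n)
    (auto intro!: continuous_at_imp_continuous_on differentiable_imp_continuous_within)

lemma Ck_on_Suc_D: "Ck_on (Suc n) S f \<Longrightarrow> Ck_on n S f"
proof (induction n arbitrary: f)
  case 0
  then show ?case using Ck_on_continuous_on[of "Suc 0"] by simp
next
  case (Suc n)
  then have "Ck_on n S (\<lambda>x. frechet_derivative f (at x) v)" for v
    by (subst (asm) Ck_on.simps(2)) blast
  then show ?case using Suc.prems by simp
qed

text \<open>Closure properties are proved by exhibiting the derivative: any formula \<open>D\<close> for it may replace
  \<^const>\<open>frechet_derivative\<close> in the recursion.\<close>
lemma Ck_on_SucI:
  assumes "open S" "\<And>x. x \<in> S \<Longrightarrow> (f has_derivative D x) (at x)"
    "\<And>v. Ck_on n S (\<lambda>x. D x v)"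
  shows "Ck_on (Suc n) S f"
proof -
  have "f differentiable at x" "frechet_derivative f (at x) = D x" if "x \<in> S" for x
    using assms(2)[OF that] by (auto simp: differentiable_def frechet_derivative_at[symmetric])
  then show ?thesis
    using Ck_on_cong[OF assms(1) _ assms(3)] by simp
qed

lemma Ck_on_SucD:
  assumes "Ck_on (Suc n) S f"
  shows "x \<in> S \<Longrightarrow> (f has_derivative frechet_derivative f (at x)) (at x)"
    "Ck_on n S (\<lambda>x. frechet_derivative f (at x) v)"
  using assms by (auto simp: frechet_derivative_works)

named_theorems Ck_intros

lemma Ck_on_const [Ck_intros]: "open S \<Longrightarrow> Ck_on n S (\<lambda>x. c)"
  by (induction n arbitrary: c) (auto intro!: Ck_on_SucI[where D="\<lambda>_ _. 0"] derivative_eq_intros simp del: Ck_on.simps(2))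

lemma Ck_on_bounded_linear:
  assumes "open S" "bounded_linear L"
  shows "Ck_on n S L"
proof (cases n)
  case 0
  then show ?thesis using assms by (simp add: linear_continuous_on)
next
  case (Suc m)
  have "Ck_on (Suc m) S L"
    by (rule Ck_on_SucI[where D="\<lambda>_. L"])
      (auto intro!: Ck_on_const assms bounded_linear.has_derivative[OF assms(2)] derivative_eq_intros)
  then show ?thesis using Suc by simp
qed

lemma Ck_on_ident [Ck_intros]: "open S \<Longrightarrow> Ck_on n S (\<lambda>x. x)"
  using Ck_on_bounded_linear[OF _ bounded_linear_ident] .

lemma Ck_on_linear_comp:
  assumes "open S" "bounded_linear L" "Ck_on n S f"
  shows "Ck_on n S (\<lambda>x. L (f x))"
  using assms(3)
proof (induction n arbitrary: f)
  case 0
  then show ?case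
    using assms(2) by (auto intro: bounded_linear.continuous_on)
next
  case (Suc n)
  show ?case
    by (rule Ck_on_SucI[OF assms(1), where D="\<lambda>x v. L (frechet_derivative f (at x) v)"])
      (auto intro!: Suc.IH Ck_on_SucD[OF Suc.prems] bounded_linear.has_derivative[OF assms(2)])
qed

lemma Ck_on_add [Ck_intros]:
  assumes "open S" "Ck_on n S f" "Ck_on n S g"
  shows "Ck_on n S (\<lambda>x. f x + g x)"
  using assms(2,3)
proof (induction n arbitrary: f g)
  case 0
  then show ?case by (auto intro: continuous_on_add)
next
  case (Suc n)
  show ?case
    by (rule Ck_on_SucI[OF assms(1),
          where D="\<lambda>x v. frechet_derivative f (at x) v + frechet_derivative g (at x) v"])
      (auto intro!: Suc.IH Ck_on_SucD[OF Suc.prems(1)] Ck_on_SucD[OF Suc.prems(2)] has_derivative_add)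
qed

text \<open>The Leibniz rule expresses the derivative of a product through products of lower class, which is what
  the induction on \<open>n\<close> needs. Scalar multiplication, inner products, Clifford multiplication and the action of
  matrices are all instances.\<close>
lemma Ck_on_bilinear:
  assumes "open S" "bounded_bilinear B" "Ck_on n S f" "Ck_on n S g"
  shows "Ck_on n S (\<lambda>x. B (f x) (g x))"
  using assms(3,4)
proof (induction n arbitrary: f g)
  case 0
  then show ?case using assms(2) by (auto intro: bounded_bilinear.continuous_on)
next
  case (Suc n)
  show ?case
    by (rule Ck_on_SucI[OF assms(1),
          where D="\<lambda>x v. B (f x) (frechet_derivative g (at x) v) + B (frechet_derivative f (at x) v) (g x)"])
      (auto intro!: Suc.IH Ck_on_add assms(1) Ck_on_SucD(2)[OF Suc.prems(1)] Ck_on_SucD(2)[OF Suc.prems(2)]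
          Ck_on_Suc_D[OF Suc.prems(1)]  Ck_on_Suc_D[OF Suc.prems(2)]
          bounded_bilinear.FDERIV[OF assms(2)] Ck_on_SucD(1)[OF Suc.prems(1)] Ck_on_SucD(1)[OF Suc.prems(2)]
          simp del: Ck_on.simps(2))
qed

lemmas Ck_on_scaleR [Ck_intros] = Ck_on_bilinear[OF _ bounded_bilinear_scaleR]
lemmas Ck_on_mult [Ck_intros] = Ck_on_bilinear[OF _ bounded_bilinear_mult]
lemmas Ck_on_inner [Ck_intros] = Ck_on_bilinear[OF _ bounded_bilinear_inner]
lemmas Ck_on_fst [Ck_intros] = Ck_on_linear_comp[OF _ bounded_linear_fst]
lemmas Ck_on_snd [Ck_intros] = Ck_on_linear_comp[OF _ bounded_linear_snd]
lemmas Ck_on_uminus [Ck_intros] = Ck_on_linear_comp[OF _ bounded_linear_minus[OF bounded_linear_ident]]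

lemma Ck_on_diff [Ck_intros]:
  "open S \<Longrightarrow> Ck_on n S f \<Longrightarrow> Ck_on n S g \<Longrightarrow> Ck_on n S (\<lambda>x. f x - g x)"
  using Ck_on_add[of S n f "\<lambda>x. - g x"] Ck_on_uminus[of S n g] by simp

lemma Ck_on_Pair [Ck_intros]:
  assumes "open S" "Ck_on n S f" "Ck_on n S g"
  shows "Ck_on n S (\<lambda>x. (f x, g x))"
proof -
  have "Ck_on n S (\<lambda>x. (f x, 0) + (0, g x))"
    by (intro Ck_on_add Ck_on_linear_comp[where L="\<lambda>y. (y, 0)"] Ck_on_linear_comp[where L="\<lambda>y. (0, y)"]
        assms bounded_linear_Pair bounded_linear_ident bounded_linear_zero)
  then show ?thesis by simp
qed

lemma Ck_on_sum [Ck_intros]: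
  assumes "open S" "\<And>i. i \<in> I \<Longrightarrow> Ck_on n S (f i)"
  shows "Ck_on n S (\<lambda>x. \<Sum>i\<in>I. f i x)"
  using assms(2) by (induction I rule: infinite_finite_induct) (auto intro!: Ck_intros assms(1))

text \<open>The chain rule produces \<open>Dg(f x)(Df(x) v)\<close>, where the direction varies with \<open>x\<close>. Expanding \<open>Df(x) v\<close>
  in a basis leaves derivatives of \<open>g\<close> in fixed directions, composed with \<open>f\<close>, to which the induction hypothesis
  applies; this is where the intermediate space has to be finite-dimensional.\<close>
lemma Ck_on_compose:
  fixes f :: "'a::real_normed_vector \<Rightarrow> 'b::euclidean_space"
  assumes "open S" "open T" "\<And>x. x \<in> S \<Longrightarrow> f x \<in> T" "Ck_on n S f" "Ck_on n T g"
  shows "Ck_on n S (\<lambda>x. g (f x))"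
  using assms(4,5)
proof (induction n arbitrary: g)
  case 0
  then show ?case using assms(3) by (auto intro: continuous_on_compose2)
next
  case (Suc n)
  let ?D = "\<lambda>x v. frechet_derivative g (at (f x)) (frechet_derivative f (at x) v)"
  have chain: "((\<lambda>x. g (f x)) has_derivative ?D x) (at x)" if "x \<in> S" for x
    using diff_chain_at[OF Ck_on_SucD(1)[OF Suc.prems(1) that]
        Ck_on_SucD(1)[OF Suc.prems(2) assms(3)[OF that]]]
    by (simp add: o_def)
  show ?case
  proof (rule Ck_on_SucI[OF assms(1) chain])
    fix v
    let ?h = "\<lambda>x. \<Sum>b\<in>Basis. (frechet_derivative f (at x) v \<bullet> b) *\<^sub>R frechet_derivative g (at (f x)) b"
    have "Ck_on n S ?h"
      by (intro Ck_intros assms(1) Suc.IH Ck_on_Suc_D[OF Suc.prems(1)]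
          Ck_on_SucD(2)[OF Suc.prems(1)] Ck_on_SucD(2)[OF Suc.prems(2)])
    moreover have "?h x = ?D x v" if "x \<in> S" for x
    proof -
      have "linear (frechet_derivative g (at (f x)))"
        using Ck_on_SucD(1)[OF Suc.prems(2) assms(3)[OF that]] has_derivative_linear by blast
      then have "frechet_derivative g (at (f x)) (\<Sum>b\<in>Basis. (frechet_derivative f (at x) v \<bullet> b) *\<^sub>R b) = ?h x"
        by (simp add: linear_sum linear_scale)
      then show ?thesis by (simp add: euclidean_representation)
    qed
    ultimately show "Ck_on n S (\<lambda>x. ?D x v)"
      by (rule Ck_on_cong[OF assms(1), rotated])
  qed
qed

text \<open>Powers with arbitrary real exponent are closed under differentiation, so that reciprocals and square roots
  are covered by one induction.\<close>
lemma Ck_on_powr: "Ck_on n {0<..} (\<lambda>x::real. x powr a)"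
proof (induction n arbitrary: a)
  case 0
  then show ?case by (auto intro!: continuous_intros)
next
  case (Suc n)
  show ?case
  proof (rule Ck_on_SucI)
    show "((\<lambda>x. x powr a) has_derivative (\<lambda>v. v * (a * x powr (a - 1)))) (at x)"
      if "x \<in> {0<..}" for x :: real
      using has_real_derivative_powr[of x a] that
      by (simp add: has_field_derivative_def mult_commute_abs)
  qed (intro open_greaterThan Ck_on_mult Ck_on_const Suc)+
qed

lemma Ck_on_inverse [Ck_intros]:
  fixes f :: "'a::real_normed_vector \<Rightarrow> real"
  assumes "open S" "Ck_on n S f" "\<And>x. x \<in> S \<Longrightarrow> f x > 0"
  shows "Ck_on n S (\<lambda>x. inverse (f x))"
proof -
  have "Ck_on n S (\<lambda>x. f x powr (-1))"
    by (rule Ck_on_compose[OF assms(1) open_greaterThan _ assms(2) Ck_on_powr])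
      (use assms(3) in auto)
  then show ?thesis
    by (rule Ck_on_cong[OF assms(1), rotated]) (simp add: assms(3) powr_minus less_imp_le)
qed

lemma Ck_on_sqrt [Ck_intros]:
  fixes f :: "'a::real_normed_vector \<Rightarrow> real"
  assumes "open S" "Ck_on n S f" "\<And>x. x \<in> S \<Longrightarrow> f x > 0"
  shows "Ck_on n S (\<lambda>x. sqrt (f x))"
proof -
  have "Ck_on n S (\<lambda>x. f x powr (1/2))"
    by (rule Ck_on_compose[OF assms(1) open_greaterThan _ assms(2) Ck_on_powr])
      (use assms(3) in auto)
  then show ?thesis
    by (rule Ck_on_cong[OF assms(1), rotated]) (simp add: assms(3) powr_half_sqrt less_imp_le)
qed

lemma Ck_on_norm [Ck_intros]:
  fixes f :: "'a::real_normed_vector \<Rightarrow> 'b::real_inner"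
  assumes "open S" "Ck_on n S f" "\<And>x. x \<in> S \<Longrightarrow> f x \<noteq> 0"
  shows "Ck_on n S (\<lambda>x. norm (f x))"
  unfolding norm_eq_sqrt_inner by (intro Ck_intros assms) (use assms(3) in auto)

lemma Ck_on_local:
  assumes "\<And>x. x \<in> S \<Longrightarrow> \<exists>U. open U \<and> x \<in> U \<and> Ck_on n U f"
  shows "Ck_on n S f"
  using assms
proof (induction n arbitrary: f)
  case 0
  show ?case unfolding Ck_on.simps
  proof (rule continuous_at_imp_continuous_on, rule ballI)
    fix x assume "x \<in> S"
    then obtain U where "open U" "x \<in> U" "continuous_on U f" using 0 by auto
    then show "isCont f x" by (simp add: continuous_on_eq_continuous_at)
  qed
next
  case (Suc n)
  then have "Ck_on n S (\<lambda>x. frechet_derivative f (at x) v)" for v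
    by (intro Suc.IH) (metis Ck_on.simps(2))
  moreover have "f differentiable at x" if "x \<in> S" for x
    using Suc.prems[OF that] by auto
  ultimately show ?case by simp
qed

lemma smooth_on_open_iff:
  assumes "open S"
  shows "smooth_on S f \<longleftrightarrow> (\<forall>n. Ck_on n S f)"
proof
  assume sm: "smooth_on S f"
  show "\<forall>n. Ck_on n S f"
  proof (intro allI Ck_on_local)
    fix n x assume "x \<in> S"
    with sm obtain U h where U: "open U" "x \<in> U" "Ck_on n U h" "\<forall>y\<in>U \<inter> S. h y = f y"
      unfolding smooth_on_def by metis
    then have "Ck_on n (U \<inter> S) f"
      by (intro Ck_on_cong[of "U \<inter> S" h f]) (auto intro: Ck_on_subset assms)
    with U \<open>x \<in> S\<close> assms show "\<exists>U. open U \<and> x \<in> U \<and> Ck_on n U f" by blast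
  qed
next
  assume "\<forall>n. Ck_on n S f"
  then show "smooth_on S f" unfolding smooth_on_def using assms by blast
qed

section \<open>Completeness of closed embedded submanifolds\<close>

text \<open>The derivative of a \<^const>\<open>valid_path\<close> may be unbounded. If the length is infinite there is nothing to
  prove; otherwise the derivative is Lebesgue integrable, and its integral agrees with the
  Henstock--Kurzweil integral in the fundamental theorem of calculus.\<close>
lemma norm_diff_le_curve_length:
  fixes c :: "real \<Rightarrow> 'a::euclidean_space"
  assumes "valid_path c"
  shows "ennreal (norm (pathfinish c - pathstart c)) \<le> curve_length c"
proof (cases "curve_length c = \<infinity>")
  case True
  then show ?thesis by simp
next
  case False
  from assms obtain T D where T: "finite T" "continuous_on {0..1} c"
    and D: "\<And>x. x \<in> {0..1} - T \<Longrightarrow> (c has_vector_derivative D x) (at x)" "continuous_on ({0..1} - T) D"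
    unfolding valid_path_def piecewise_C1_differentiable_on_def C1_differentiable_on_def by blast
  \<comment> \<open>The derivative, set to zero at the exceptional points and outside the unit interval.\<close>
  define g where "g = (\<lambda>t. indicator ({0..1} - T) t *\<^sub>R D t)"
  have "{0..1} - T \<in> sets borel"
    using T(1) by (auto intro: sets.Diff borel_closed finite_imp_closed)
  then have meas: "g \<in> borel_measurable borel"
    unfolding g_def using borel_measurable_continuous_on_indicator D(2) by blast
  have "AE t in lborel. t \<notin> T"
    using AE_not_in[OF finite_imp_null_set_lborel[OF T(1)]] .
  then have len: "curve_length c = (\<integral>\<^sup>+t. ennreal (norm (g t)) \<partial>lborel)"
    unfolding curve_length_def
    by (intro nn_integral_cong_AE, eventually_elim)
      (auto simp: g_def indicator_def vector_derivative_at[OF D(1)])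
  have int: "integrable lborel g"
    using meas False len by (intro integrableI_bounded) (auto simp: top.not_eq_extremum)
  have "(D has_integral c 1 - c 0) {0..1}"
    by (rule fundamental_theorem_of_calculus_interior_strong[OF T(1)]) (use T D in auto)
  then have "(g has_integral c 1 - c 0) {0..1}"
    by (rule has_integral_spike_finite[OF T(1), rotated]) (auto simp: g_def)
  then have "(g has_integral c 1 - c 0) UNIV"
    by (rule has_integral_on_superset) (auto simp: g_def)
  moreover have "(g has_integral integral\<^sup>L lborel g) UNIV"
    using has_integral_integral_lborel[OF int] .
  ultimately have "c 1 - c 0 = integral\<^sup>L lborel g"
    using has_integral_unique by blast
  then show ?thesis
    using integral_norm_bound_ennreal[OF int] by (simp add: len pathfinish_def pathstart_def)
qed

lemma dist_le_intrinsic_dist: "ennreal (dist x y) \<le> intrinsic_dist S x y"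
  unfolding intrinsic_dist_def
proof (rule INF_greatest, clarify)
  fix c assume c: "valid_path c" "path_image c \<subseteq> S" "x = pathstart c" "y = pathfinish c"
  then show "ennreal (dist (pathstart c) (pathfinish c)) \<le> curve_length c"
    using norm_diff_le_curve_length[OF c(1)] by (simp add: dist_norm norm_minus_commute)
qed

text \<open>A straight segment in a chart is mapped to a curve whose speed is the derivative of the
  parametrisation in the direction of the segment.\<close>
lemma intrinsic_dist_chart_segment:
  fixes \<psi> :: "'a::euclidean_space \<Rightarrow> 'b::euclidean_space"
  assumes "open V" "Ck_on 1 V \<psi>" "closed_segment a b \<subseteq> V" "\<psi> ` closed_segment a b \<subseteq> S"
    and bound: "\<And>y. y \<in> closed_segment a b \<Longrightarrow> norm (frechet_derivative \<psi> (at y) (b - a)) \<le> K"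
  shows "intrinsic_dist S (\<psi> a) (\<psi> b) \<le> ennreal K"
proof -
  define l where "l t = (1 - t) *\<^sub>R a + t *\<^sub>R b" for t :: real
  define c where "c = \<psi> \<circ> l"
  have l: "l t \<in> closed_segment a b" if "t \<in> {0..1}" for t
    using that unfolding l_def closed_segment_def by auto
  have dl: "(l has_vector_derivative b - a) (at t)" for t
    unfolding l_def by (auto intro!: derivative_eq_intros simp: algebra_simps)
  have dc: "(c has_vector_derivative frechet_derivative \<psi> (at (l t)) (b - a)) (at t)" if "t \<in> {0..1}" for t
  proof -
    have "(\<psi> has_derivative frechet_derivative \<psi> (at (l t))) (at (l t))"
      using assms(2,3) l[OF that] Ck_on_SucD(1)[of 0 V \<psi>] by auto
    from diff_chain_at[OF dl[of t, unfolded has_vector_derivative_def] this] show ?thesis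
      unfolding c_def has_vector_derivative_def o_def
      by (simp add: linear_cmul[OF has_derivative_linear[OF \<open>(\<psi> has_derivative _) _\<close>]])
  qed
  have "continuous_on V (\<lambda>y. frechet_derivative \<psi> (at y) (b - a))"
    using assms(2) by auto
  then have cont: "continuous_on {0..1} (\<lambda>t. frechet_derivative \<psi> (at (l t)) (b - a))"
    by (rule continuous_on_compose2[of V _ _ l])
      (use assms(3) l in \<open>auto simp: l_def intro!: continuous_intros\<close>)
  have "c C1_differentiable_on {0..1}"
    unfolding C1_differentiable_on_def by (intro exI conjI ballI, rule dc) (auto intro: cont)
  then have vp: "valid_path c"
    unfolding valid_path_def by (rule C1_differentiable_imp_piecewise)
  have "path_image c \<subseteq> S" "pathstart c = \<psi> a" "pathfinish c = \<psi> b"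
    using assms(4) l by (auto simp: path_image_def c_def pathstart_def pathfinish_def l_def)
  with vp have "intrinsic_dist S (\<psi> a) (\<psi> b) \<le> curve_length c"
    unfolding intrinsic_dist_def by (auto intro: INF_lower)
  also have "\<dots> \<le> (\<integral>\<^sup>+t\<in>{0..1}. ennreal K \<partial>(lborel :: real measure))"
    unfolding curve_length_def
    by (intro nn_integral_mono)
      (simp add: indicator_def vector_derivative_at[OF dc] ennreal_leI bound l)
  also have "\<dots> = ennreal K" by (simp add: nn_integral_cmult_indicator)
  finally show ?thesis .
qed

lemma frechet_derivative_locally_bounded:
  fixes \<psi> :: "'a::euclidean_space \<Rightarrow> 'b::euclidean_space"
  assumes "open V" "Ck_on 1 V \<psi>" "compact C" "C \<subseteq> V"
  shows "\<exists>K\<ge>0. \<forall>y\<in>C. \<forall>v. norm (frechet_derivative \<psi> (at y) v) \<le> K * norm v"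
proof -
  have "\<exists>M\<ge>0. \<forall>y\<in>C. norm (frechet_derivative \<psi> (at y) b) \<le> M" for b
  proof -
    have "continuous_on C (\<lambda>y. frechet_derivative \<psi> (at y) b)"
      using assms(2,4) by (auto intro: continuous_on_subset)
    then have "bounded ((\<lambda>y. frechet_derivative \<psi> (at y) b) ` C)"
      using assms(3) compact_continuous_image compact_imp_bounded by blast
    then obtain M where "M > 0" "\<forall>x\<in>(\<lambda>y. frechet_derivative \<psi> (at y) b) ` C. norm x \<le> M"
      unfolding bounded_pos by blast
    then show ?thesis by (intro exI[of _ M]) auto
  qed
  then obtain M where M: "\<And>b. M b \<ge> 0" "\<And>b y. y \<in> C \<Longrightarrow> norm (frechet_derivative \<psi> (at y) b) \<le> M b"
    by metis
  show ?thesis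
  proof (intro exI[of _ "\<Sum>b\<in>Basis. M b"] conjI ballI allI sum_nonneg M(1))
    fix y v assume y: "y \<in> C"
    have lin: "linear (frechet_derivative \<psi> (at y))"
      using assms y Ck_on_SucD(1)[of 0 V \<psi> y] has_derivative_linear by auto
    have "frechet_derivative \<psi> (at y) v = frechet_derivative \<psi> (at y) (\<Sum>b\<in>Basis. (v \<bullet> b) *\<^sub>R b)"
      by (simp add: euclidean_representation)
    also have "\<dots> = (\<Sum>b\<in>Basis. (v \<bullet> b) *\<^sub>R frechet_derivative \<psi> (at y) b)"
      by (simp add: linear_sum[OF lin] linear_scale[OF lin])
    also have "norm \<dots> \<le> (\<Sum>b\<in>Basis. \<bar>v \<bullet> b\<bar> * norm (frechet_derivative \<psi> (at y) b))"
      by (rule order_trans[OF norm_sum]) simp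
    also have "\<dots> \<le> (\<Sum>b\<in>Basis. norm v * M b)"
      by (intro sum_mono mult_mono Basis_le_norm M y) auto
    finally show "norm (frechet_derivative \<psi> (at y) v) \<le> sum M Basis * norm v"
      by (simp add: sum_distrib_left mult.commute)
  qed
qed

text \<open>A sequence that is Cauchy intrinsically is Cauchy in the ambient space, so it converges to a point of the
  closed set. In a chart around the limit the leaf is a piece of a linear subspace, hence locally convex,
  and the chart is locally Lipschitz; segments then show that convergence in the ambient space implies
  intrinsic convergence.\<close>
lemma closed_embedded_imp_complete:
  assumes "closed S" "embedded_submanifold d S"
  shows "complete_submanifold S"
  unfolding complete_submanifold_def
proof (intro allI impI, elim conjE)
  fix X :: "nat \<Rightarrow> 'a"
  assume XS: "\<forall>n. X n \<in> S"
    and Cau: "\<forall>e>0. \<exists>N. \<forall>m\<ge>N. \<forall>n\<ge>N. intrinsic_dist S (X m) (X n) < e"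
  have "Cauchy X"
    unfolding Cauchy_def
  proof (intro allI impI)
    fix e :: real assume "e > 0"
    then have "ennreal e > 0" by simp
    with Cau obtain N where N: "\<forall>m\<ge>N. \<forall>n\<ge>N. intrinsic_dist S (X m) (X n) < ennreal e"
      by blast
    have "dist (X m) (X n) < e" if "m \<ge> N" "n \<ge> N" for m n
    proof -
      have "ennreal (dist (X m) (X n)) < ennreal e"
        using N that by (intro order_le_less_trans[OF dist_le_intrinsic_dist]) blast
      then show ?thesis by (simp add: ennreal_less_iff)
    qed
    then show "\<exists>M. \<forall>m\<ge>M. \<forall>n\<ge>M. dist (X m) (X n) < e" by blast
  qed
  then obtain p where p: "X \<longlonglongrightarrow> p"
    using convergent_eq_Cauchy by blast
  have pS: "p \<in> S"
    using assms(1) XS p closed_sequentially by blast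
  then obtain U V and E :: "'a set" and \<phi> \<psi> where ch: "homeomorphism U V \<phi> \<psi>"
    "open U" "p \<in> U" "open V" "subspace E" "smooth_on V \<psi>" "\<phi> ` (U \<inter> S) = V \<inter> E"
    using assms(2) unfolding embedded_submanifold_def by metis
  have ck: "Ck_on 1 V \<psi>" using smooth_on_open_iff ch by blast
  have inv: "\<And>x. x \<in> U \<Longrightarrow> \<psi> (\<phi> x) = x" "\<And>y. y \<in> V \<Longrightarrow> \<phi> (\<psi> y) = y"
    using ch(1) by (auto simp: homeomorphism_def)
  have "\<phi> p \<in> V" using ch by (auto simp: homeomorphism_def)
  then obtain r where r: "r > 0" "cball (\<phi> p) r \<subseteq> V"
    using ch(4) open_contains_cball by blast
  obtain K where K: "K \<ge> 0" "\<And>y v. y \<in> cball (\<phi> p) r \<Longrightarrow> norm (frechet_derivative \<psi> (at y) v) \<le> K * norm v"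
    using frechet_derivative_locally_bounded[OF ch(4) ck compact_cball r(2)] by metis
  have "isCont \<phi> p"
    using ch by (simp add: homeomorphism_def continuous_on_eq_continuous_at)
  with p have lim: "(\<lambda>n. \<phi> (X n)) \<longlonglongrightarrow> \<phi> p"
    by (rule isCont_tendsto_compose[rotated])
  have "\<forall>\<^sub>F n in sequentially. X n \<in> U"
    using p ch topological_tendstoD by blast
  moreover have "\<forall>\<^sub>F n in sequentially. dist (\<phi> (X n)) (\<phi> p) < r"
    using lim r(1) tendstoD by blast
  ultimately have le: "\<forall>\<^sub>F n in sequentially. intrinsic_dist S (X n) p \<le> ennreal (K * dist (\<phi> (X n)) (\<phi> p))"
  proof eventually_elim
    case (elim n)
    let ?I = "closed_segment (\<phi> (X n)) (\<phi> p)"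
    have inE: "\<phi> (X n) \<in> E" "\<phi> p \<in> E" using ch elim XS pS by auto
    have sub: "?I \<subseteq> cball (\<phi> p) r"
      using elim r(1) by (intro closed_segment_subset) (auto simp: dist_commute)
    have "?I \<subseteq> E"
      using inE subspace_imp_convex[OF ch(5)] by (intro closed_segment_subset)
    then have "?I \<subseteq> \<phi> ` (U \<inter> S)" using sub r(2) ch(7) by blast
    then have "\<psi> ` ?I \<subseteq> S" using inv by auto
    then have "intrinsic_dist S (\<psi> (\<phi> (X n))) (\<psi> (\<phi> p)) \<le> ennreal (K * norm (\<phi> p - \<phi> (X n)))"
      using sub r(2) by (intro intrinsic_dist_chart_segment[OF ch(4) ck] K(2)) auto
    then show ?case using inv elim ch(3) by (simp add: dist_norm norm_minus_commute)
  qed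
  have "(\<lambda>n. K * dist (\<phi> (X n)) (\<phi> p)) \<longlonglongrightarrow> 0"
    using tendsto_mult_right_zero[OF tendsto_dist_iff[THEN iffD1, OF lim]] by blast
  then have bound: "(\<lambda>n. ennreal (K * dist (\<phi> (X n)) (\<phi> p))) \<longlonglongrightarrow> 0"
    using tendsto_ennrealI[of _ 0] by simp
  have "(\<lambda>n. intrinsic_dist S (X n) p) \<longlonglongrightarrow> 0"
    by (rule tendsto_sandwich[OF _ le tendsto_const bound]) simp
  with pS show "\<exists>p\<in>S. (\<lambda>n. intrinsic_dist S (X n) p) \<longlonglongrightarrow> 0" by blast
qed

section \<open>Octonions and Clifford multiplication\<close>

lemma quat_mult_alt: "quat_mult p q = (fst p * fst q - cnj (snd q) * snd p, snd q * fst p + snd p * cnj (fst q))"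
  by (cases p; cases q) simp
lemma quat_cnj_alt: "quat_cnj p = (cnj (fst p), - snd p)"
  by (cases p) simp
lemma oct_cnj_alt: "oct_cnj p = (quat_cnj (fst p), - snd p)"
  by (cases p) simp
lemma oct_mult_alt: "oct_mult p q =
    (quat_mult (fst p) (fst q) - quat_mult (quat_cnj (snd q)) (snd p), quat_mult (snd q) (fst p) + quat_mult (snd p) (quat_cnj (fst q)))"
  by (cases p; cases q) simp
lemmas oct_alt = oct_mult_alt oct_cnj_alt quat_mult_alt quat_cnj_alt

text \<open>One half of the alternative law. On the four complex components it is a polynomial identity in commuting
  variables and their conjugates.\<close>
lemma oct_mult_cnj_left: "oct_mult (oct_cnj p) (oct_mult p y) = (norm p)\<^sup>2 *\<^sub>R y"
proof -
  have 1: "z *\<^sub>R w = of_real z * w" for z and w :: complex by (simp add: scaleR_conv_of_real)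
  have 2: "complex_of_real ((norm p)\<^sup>2) = fst (fst p) * cnj (fst (fst p)) + snd (fst p) * cnj (snd (fst p))
    + fst (snd p) * cnj (fst (snd p)) + snd (snd p) * cnj (snd (snd p))"
    by (simp add: norm_prod_def complex_norm_square[symmetric])
  show ?thesis
    by (intro prod_eqI; simp only: fst_scaleR snd_scaleR 1 2) (simp_all add: oct_alt algebra_simps)
qed

lemma oct_cnj_cnj [simp]: "oct_cnj (oct_cnj p) = p"
  by (simp add: oct_alt)

lemma norm_oct_cnj [simp]: "norm (oct_cnj p) = norm p"
  by (simp add: oct_alt norm_prod_def)

lemma oct_mult_mult_cnj: "oct_mult p (oct_mult (oct_cnj p) y) = (norm p)\<^sup>2 *\<^sub>R y"
  using oct_mult_cnj_left[of "oct_cnj p"] by simp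

lemma inner_oct_mult: "oct_mult p y \<bullet> x = y \<bullet> oct_mult (oct_cnj p) x"
  by (simp add: oct_alt inner_prod_def inner_complex_def algebra_simps)

lemma oct_part_add: "oct_part (v + w) = oct_part v + oct_part w"
  by (simp add: oct_part_def complex_eq_iff)
lemma oct_part_scaleR: "oct_part (r *\<^sub>R v) = r *\<^sub>R oct_part v"
  by (simp add: oct_part_def complex_eq_iff)

lemma oct_mult_add_left: "oct_mult (p + q) y = oct_mult p y + oct_mult q y"
  and oct_mult_add_right: "oct_mult y (p + q) = oct_mult y p + oct_mult y q"
  and oct_mult_scaleR_left: "oct_mult (r *\<^sub>R p) y = r *\<^sub>R oct_mult p y"
  and oct_mult_scaleR_right: "oct_mult y (r *\<^sub>R p) = r *\<^sub>R oct_mult y p"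
  and oct_cnj_add: "oct_cnj (p + q) = oct_cnj p + oct_cnj q"
  and oct_cnj_scaleR: "oct_cnj (r *\<^sub>R p) = r *\<^sub>R oct_cnj p"
  by (simp_all add: oct_alt algebra_simps scaleR_conv_of_real)

lemma exhaust_9:
  fixes x :: 9
  shows "x = 1 \<or> x = 2 \<or> x = 3 \<or> x = 4 \<or> x = 5 \<or> x = 6 \<or> x = 7 \<or> x = 8 \<or> x = 9"
proof (induct x)
  case (of_int z)
  then have "0 \<le> z" and "z < 9" by simp_all
  then have "z = 0 \<or> z = 1 \<or> z = 2 \<or> z = 3 \<or> z = 4 \<or> z = 5 \<or> z = 6 \<or> z = 7 \<or> z = 8" by arith
  then show ?case by auto
qed

lemma UNIV_9: "UNIV = {1::9, 2, 3, 4, 5, 6, 7, 8, 9}"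
  using exhaust_9 by auto

lemma sum_9: "sum f (UNIV::9 set) = f 1 + f 2 + f 3 + f 4 + f 5 + f 6 + f 7 + f 8 + f 9"
  unfolding UNIV_9 by (simp add: ac_simps)

lemma inner_oct_part: "v \<bullet> w = v $ 1 * w $ 1 + oct_part v \<bullet> oct_part w"
  by (simp add: inner_vec_def sum_9 oct_part_def inner_prod_def inner_complex_def)

text \<open>The inverse of the isomorphism \<open>v \<mapsto> (v $ 1, oct_part v)\<close> of \<open>\<real>\<^sup>9\<close> with \<open>\<real> \<oplus> \<O>\<close>.\<close>
definition vec9 :: "real \<Rightarrow> octonion \<Rightarrow> real ^ 9" where
  "vec9 a p = (\<chi> i. if i = 1 then a else if i = 2 then Re (fst (fst p)) else if i = 3 then Im (fst (fst p))
   else if i = 4 then Re (snd (fst p)) else if i = 5 then Im (snd (fst p))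
   else if i = 6 then Re (fst (snd p)) else if i = 7 then Im (fst (snd p))
   else if i = 8 then Re (snd (snd p)) else Im (snd (snd p)))"

lemma vec9_1 [simp]: "vec9 a p $ 1 = a" and oct_part_vec9 [simp]: "oct_part (vec9 a p) = p"
  by (simp_all add: vec9_def oct_part_def prod_eq_iff complex_eq_iff)

lemma clifford_alt: "clifford v s = ((v $ 1) *\<^sub>R fst s + oct_mult (oct_part v) (snd s),
    oct_mult (oct_cnj (oct_part v)) (fst s) - (v $ 1) *\<^sub>R snd s)"
  by (cases s) simp

lemma clifford_add_left: "clifford (v + w) s = clifford v s + clifford w s"
  and clifford_add_right: "clifford v (s + t) = clifford v s + clifford v t"
  and clifford_scaleR_left: "clifford (r *\<^sub>R v) s = r *\<^sub>R clifford v s"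
  and clifford_scaleR_right: "clifford v (r *\<^sub>R s) = r *\<^sub>R clifford v s"
  by (simp_all add: clifford_alt oct_part_add oct_part_scaleR oct_mult_add_left oct_mult_add_right oct_cnj_add
    oct_mult_scaleR_left oct_mult_scaleR_right oct_cnj_scaleR algebra_simps)

lemma bilinear_clifford: "bilinear clifford"
  unfolding bilinear_def
  by (intro conjI allI linearI clifford_add_left clifford_add_right clifford_scaleR_left
      clifford_scaleR_right)

lemma bounded_bilinear_clifford: "bounded_bilinear clifford"
  using bilinear_clifford bilinear_conv_bounded_bilinear by blast

lemma clifford_symmetric: "clifford v s \<bullet> t = s \<bullet> clifford v t"
proof -
  obtain x y x' y' where "s = (x, y)" "t = (x', y')" by (metis surj_pair)
  then show ?thesis
    using inner_oct_mult[of "oct_part v" y x'] inner_oct_mult[of "oct_cnj (oct_part v)" x y']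
    by (simp add: inner_add_left inner_add_right inner_diff_left inner_diff_right)
qed

lemma oct_mult_diff_right: "oct_mult y (p - q) = oct_mult y p - oct_mult y q"
  using oct_mult_add_right[of y "p - q" q] by (simp add: algebra_simps)

lemma norm_oct_part: "(norm v)\<^sup>2 = (v $ 1)\<^sup>2 + (norm (oct_part v))\<^sup>2"
  unfolding power2_norm_eq_inner inner_oct_part[of v v] by (simp add: power2_eq_square)

lemma clifford_square: "clifford v (clifford v s) = (norm v)\<^sup>2 *\<^sub>R s"
proof -
  obtain x y where "s = (x, y)" by (metis surj_pair)
  then show ?thesis
    by (simp add: oct_mult_add_right oct_mult_diff_right oct_mult_scaleR_right norm_oct_part[unfolded power2_eq_square]
        oct_mult_cnj_left oct_mult_mult_cnj power2_eq_square scaleR_add_left scaleR_add_right scaleR_diff_right add.commute)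
qed

text \<open>Polarisation of \<open>clifford_square\<close>.\<close>
lemma clifford_anticommute:
  "clifford u (clifford v s) + clifford v (clifford u s) = (2 * (u \<bullet> v)) *\<^sub>R s"
  using clifford_square[of "u + v" s] unfolding power2_norm_eq_inner
  by (simp add: clifford_add_left clifford_add_right clifford_square inner_add_left inner_add_right
      inner_commute power2_norm_eq_inner algebra_simps)

section \<open>The Hopf map as a quadratic map on spinors\<close>

definition hopf_map :: "octonion \<times> octonion \<Rightarrow> real ^ 9"
  where "hopf_map s = (\<chi> i. s \<bullet> clifford (axis i 1) s)"

text \<open>The symmetric bilinear map that polarises \<^const>\<open>hopf_map\<close>.\<close>
definition hopf_polar :: "octonion \<times> octonion \<Rightarrow> octonion \<times> octonion \<Rightarrow> real ^ 9"
  where "hopf_polar s t = (\<chi> i. s \<bullet> clifford (axis i 1) t)"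

lemma inner_hopf_polar: "hopf_polar s t \<bullet> v = s \<bullet> clifford v t"
proof -
  interpret bounded_bilinear clifford by (rule bounded_bilinear_clifford)
  have "s \<bullet> clifford v t = s \<bullet> clifford (\<Sum>i\<in>UNIV. (v $ i) *\<^sub>R axis i 1) t"
    using basis_expansion[of v] by (simp add: scalar_mult_eq_scaleR)
  also have "\<dots> = hopf_polar s t \<bullet> v"
    by (simp add: sum_left scaleR_left inner_sum_right hopf_polar_def inner_vec_def mult.commute)
  finally show ?thesis by simp
qed

lemma hopf_map_polar: "hopf_map s = hopf_polar s s"
  by (simp add: hopf_map_def hopf_polar_def)

lemma inner_hopf_map: "hopf_map s \<bullet> v = s \<bullet> clifford v s"
  by (simp add: hopf_map_polar inner_hopf_polar)

text \<open>The familiar formula \<open>(x, y) \<mapsto> (\<bar>x\<bar>\<^sup>2 - \<bar>y\<bar>\<^sup>2, 2 x y\<^sup>*)\<close> of the Hopf map.\<close>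
lemma hopf_map_components:
  "hopf_map (x, y) = vec9 ((norm x)\<^sup>2 - (norm y)\<^sup>2) (2 *\<^sub>R oct_mult x (oct_cnj y))"
proof (rule vector_eq_rdot[THEN iffD1], intro allI)
  fix v
  have swap: "x \<bullet> oct_mult p y = oct_mult x (oct_cnj y) \<bullet> p" for p
    by (simp add: oct_alt inner_prod_def inner_complex_def algebra_simps)
  have "hopf_map (x, y) \<bullet> v = (x \<bullet> x - y \<bullet> y) * v $ 1 + 2 * (x \<bullet> oct_mult (oct_part v) y)"
    using inner_oct_mult[of "oct_part v" y x]
    unfolding inner_hopf_map by (simp add: inner_add_right inner_diff_right inner_commute algebra_simps)
  then show "hopf_map (x, y) \<bullet> v = vec9 ((norm x)\<^sup>2 - (norm y)\<^sup>2) (2 *\<^sub>R oct_mult x (oct_cnj y)) \<bullet> v"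
    unfolding inner_oct_part[of "vec9 _ _"] by (simp add: swap power2_norm_eq_inner)
qed

lemma norm_oct_mult: "norm (oct_mult p y) = norm p * norm y"
proof -
  have "(norm (oct_mult p y))\<^sup>2 = (norm p * norm y)\<^sup>2"
    using inner_oct_mult[of p y "oct_mult p y"]
    by (simp add: power2_norm_eq_inner[of "oct_mult p y"] oct_mult_cnj_left power_mult_distrib power2_norm_eq_inner)
  then show ?thesis by simp
qed

text \<open>Since \<open>\<bar>x y\<^sup>*\<bar> = \<bar>x\<bar> \<bar>y\<bar>\<close>, this is
  \<open>(\<bar>x\<bar>\<^sup>2 - \<bar>y\<bar>\<^sup>2)\<^sup>2 + 4 \<bar>x\<bar>\<^sup>2 \<bar>y\<bar>\<^sup>2 = (\<bar>x\<bar>\<^sup>2 + \<bar>y\<bar>\<^sup>2)\<^sup>2\<close>. Together with the Clifford relations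
  this equation determines the geometry of the fibres.\<close>
lemma norm_hopf_map: "norm (hopf_map s) = (norm s)\<^sup>2"
proof -
  obtain x y where s: "s = (x, y)" by (metis surj_pair)
  have "(norm (hopf_map s))\<^sup>2 = ((norm s)\<^sup>2)\<^sup>2"
    unfolding s hopf_map_components norm_oct_part
    by (simp add: norm_oct_mult norm_Pair power2_eq_square algebra_simps)
  then show ?thesis by (rule power2_eq_imp_eq) auto
qed

(* Spinors are treated as single vectors from here on, so quantifiers over them must not be split
   into quantifiers over complex components. *)
declare split_paired_All [simp del] split_paired_Ex [simp del]

lemma oct_cnj_one [simp]: "oct_cnj oct_one = oct_one"
  by simp
lemma oct_mult_one [simp]: "oct_mult oct_one p = p" "oct_mult p oct_one = p"
  by (simp_all add: oct_alt prod_eq_iff)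
lemma oct_mult_0 [simp]: "oct_mult 0 p = 0" "oct_mult p 0 = 0"
  by (simp_all add: oct_alt zero_prod_def)
lemma oct_cnj_0 [simp]: "oct_cnj 0 = 0"
  by (simp add: oct_alt zero_prod_def)
lemma oct_part_axis_1: "oct_part (axis 1 1) = 0"
  by (simp add: oct_part_def axis_def zero_prod_def complex_eq_iff)

text \<open>For \<open>w = h s\<close> the vectors \<open>s\<close> and \<open>w s\<close> have norms \<open>\<bar>s\<bar>\<close> and \<open>\<bar>s\<bar>\<^sup>3\<close> and inner product \<open>\<bar>w\<bar>\<^sup>2 = \<bar>s\<bar>\<^sup>4\<close>, so the
  Cauchy--Schwarz inequality is an equality and they are parallel.\<close>
lemma hopf_map_eq_iff:
  "hopf_map s = w \<longleftrightarrow> clifford w s = norm w *\<^sub>R s \<and> (norm s)\<^sup>2 = norm w"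
proof
  assume w: "hopf_map s = w"
  then have n: "norm w = (norm s)\<^sup>2" by (simp add: norm_hopf_map[symmetric])
  have "(norm (clifford w s))\<^sup>2 = (norm w * norm s)\<^sup>2"
    using clifford_symmetric[of w s "clifford w s"]
    by (simp add: clifford_square power2_norm_eq_inner[of "clifford w s"] power_mult_distrib power2_norm_eq_inner)
  then have nc: "norm (clifford w s) = norm w * norm s"
    by (rule power2_eq_imp_eq) auto
  have "s \<bullet> clifford w s = norm s * norm (clifford w s)"
    using inner_hopf_map[of s w] w n by (simp add: nc power2_norm_eq_inner[symmetric] power2_eq_square)
  then have "norm s *\<^sub>R clifford w s = (norm w * norm s) *\<^sub>R s"
    using norm_cauchy_schwarz_eq[of s "clifford w s"] nc by simp
  then have "norm s *\<^sub>R (clifford w s - norm w *\<^sub>R s) = 0"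
    by (simp add: scaleR_diff_right mult.commute)
  then have "clifford w s = norm w *\<^sub>R s"
    by (cases "s = 0") (auto simp: clifford_scaleR_right[of w 0 0, simplified])
  with n show "clifford w s = norm w *\<^sub>R s \<and> (norm s)\<^sup>2 = norm w" by simp
next
  assume a: "clifford w s = norm w *\<^sub>R s \<and> (norm s)\<^sup>2 = norm w"
  then have "hopf_map s \<bullet> w = norm w * norm w"
    by (simp add: inner_hopf_map power2_norm_eq_inner[symmetric])
  then have "(norm (hopf_map s - w))\<^sup>2 = 0"
    using a norm_hopf_map[of s]
    by (simp add: power2_norm_eq_inner inner_diff_left inner_diff_right inner_commute)
      (simp add: power2_norm_eq_inner[symmetric] power2_eq_square)
  then show "hopf_map s = w" by simp
qed

lemma hopf_map_scaleR: "hopf_map (r *\<^sub>R s) = r\<^sup>2 *\<^sub>R hopf_map s"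
  by (simp add: hopf_map_def vec_eq_iff clifford_scaleR_right power2_eq_square)

lemma clifford_minus_left: "clifford (- v) s = - clifford v s"
  using clifford_scaleR_left[of "-1" v s] by simp

lemma clifford_diff_left: "clifford (u - v) s = clifford u s - clifford v s"
  using clifford_add_left[of u "- v" s] by (simp add: clifford_minus_left)

lemma hopf_map_eq_0_iff [simp]: "hopf_map s = 0 \<longleftrightarrow> s = 0"
  using norm_hopf_map[of s] by (metis norm_eq_zero power_eq_0_iff zero_power2)

lemma hopf_map_0 [simp]: "hopf_map 0 = 0" by simp

lemma norm_clifford: "norm (clifford v s) = norm v * norm s"
proof (rule power2_eq_imp_eq)
  show "(norm (clifford v s))\<^sup>2 = (norm v * norm s)\<^sup>2"
    using clifford_symmetric[of v s "clifford v s"]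
    by (simp add: clifford_square power2_norm_eq_inner[of "clifford v s"] power_mult_distrib power2_norm_eq_inner)
qed auto

text \<open>Let \<open>e = h c\<close>. Every \<open>t\<close> in the \<open>-1\<close> eigenspace of \<open>e\<close> is \<open>u c\<close> for the vector \<open>u\<close> with
  \<open>\<langle>u, v\<rangle> = \<langle>c, v t\<rangle>\<close>; for octonions this is division by \<open>c\<close>. Comparing \<open>\<bar>h(c + t)\<bar> = \<bar>c + t\<bar>\<^sup>2\<close> with the
  expansion \<open>h(c + t) = (1 - \<bar>t\<bar>\<^sup>2) e + 2 u\<close> gives \<open>\<bar>u\<bar> = \<bar>t\<bar>\<close>, and then \<open>\<langle>u c, t\<rangle> = \<bar>u\<bar>\<^sup>2\<close> is the equality case of
  Cauchy--Schwarz.\<close>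
lemma clifford_hopf_polar:
  assumes "norm c = 1" "clifford (hopf_map c) t = - t"
  shows "clifford (hopf_polar c t) c = t"
proof -
  let ?u = "hopf_polar c t" and ?e = "hopf_map c"
  have ec: "clifford ?e c = c"
    using hopf_map_eq_iff[of c ?e] assms(1) by simp
  have ct: "c \<bullet> t = 0"
    using clifford_symmetric[of ?e c t] ec assms(2) by simp
  then have ue: "?u \<bullet> ?e = 0"
    by (simp add: inner_hopf_polar assms(2))
  have ht: "hopf_map t = - (norm t)\<^sup>2 *\<^sub>R ?e"
    unfolding hopf_map_eq_iff using assms(2) norm_hopf_map[of c] assms(1)
    by (simp add: clifford_scaleR_left clifford_minus_left)
  have "hopf_map (c + t) = hopf_map c + hopf_map t + 2 *\<^sub>R ?u"
  proof (rule vector_eq_rdot[THEN iffD1], intro allI)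
    fix v
    show "hopf_map (c + t) \<bullet> v = (hopf_map c + hopf_map t + 2 *\<^sub>R ?u) \<bullet> v"
      using clifford_symmetric[of v c t]
      unfolding inner_hopf_map inner_add_left inner_scaleR_left inner_hopf_polar
      by (simp add: clifford_add_right inner_add_left inner_add_right inner_commute)
  qed
  then have sum: "hopf_map (c + t) = (1 - (norm t)\<^sup>2) *\<^sub>R ?e + 2 *\<^sub>R ?u"
    by (simp add: ht scaleR_diff_left)
  have e1: "?e \<bullet> ?e = 1" using norm_hopf_map[of c] assms(1) by (simp add: power2_norm_eq_inner[symmetric])
  have "(norm (hopf_map (c + t)))\<^sup>2 = (1 - (norm t)\<^sup>2)\<^sup>2 + 4 * (norm ?u)\<^sup>2"
    unfolding sum using ue e1 unfolding power2_norm_eq_inner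
    by (simp add: inner_add_left inner_add_right inner_commute power2_eq_square)
  moreover have "(norm (c + t))\<^sup>2 = 1 + (norm t)\<^sup>2"
    using ct assms(1) by (simp add: power2_norm_eq_inner inner_add_left inner_add_right inner_commute norm_eq_1)
  ultimately have "(1 + (norm t)\<^sup>2)\<^sup>2 = (1 - (norm t)\<^sup>2)\<^sup>2 + 4 * (norm ?u)\<^sup>2"
    by (simp add: norm_hopf_map)
  then have nu: "norm ?u ^ 2 = norm t ^ 2"
    by (simp add: power2_eq_square algebra_simps)
  have "clifford ?u c \<bullet> t = norm ?u ^ 2"
    using inner_hopf_polar[of c t ?u] by (simp add: clifford_symmetric power2_norm_eq_inner)
  moreover have "(norm (clifford ?u c))\<^sup>2 = norm ?u ^ 2"
    by (simp add: norm_clifford assms(1))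
  ultimately have "(norm (clifford ?u c - t))\<^sup>2 = 0"
    using nu by (simp add: power2_norm_eq_inner inner_diff_left inner_diff_right inner_commute)
  then show ?thesis by simp
qed

section \<open>Reflections generate the orthogonal group\<close>

definition refl_mat :: "real ^ 'n \<Rightarrow> real ^ 'n ^ 'n"
  where "refl_mat u = matrix (\<lambda>v. v - (2 * (u \<bullet> v)) *\<^sub>R u)"

lemma refl_mat_apply: "refl_mat u *v v = v - (2 * (u \<bullet> v)) *\<^sub>R u"
  unfolding refl_mat_def
  by (rule matrix_works, subst linear_matrix_vector_mul_eq)
    (auto intro!: linearI simp: inner_add_right algebra_simps)

lemma orthogonal_matrix_inner:
  fixes A :: "real ^ 'n ^ 'n"
  assumes "orthogonal_matrix A" shows "(A *v x) \<bullet> (A *v y) = x \<bullet> y"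
  using assms
  by (metis orthogonal_transformation_matrix matrix_of_matrix_vector_mul matrix_vector_mul_linear orthogonal_transformation_def)

lemma matrix_eqI: "(\<And>v. (A::real^'n^'m) *v v = B *v v) \<Longrightarrow> A = B"
  by (simp add: matrix_eq)

lemma refl_mat_involution:
  assumes "norm u = 1" shows "refl_mat u ** refl_mat u = mat 1"
  by (rule matrix_eqI)
    (use assms in \<open>simp add: matrix_vector_mul_assoc[symmetric] refl_mat_apply inner_diff_right norm_eq_1\<close>)

lemma orthogonal_refl_mat:
  assumes "norm u = 1" shows "orthogonal_matrix (refl_mat u)"
proof -
  have "orthogonal_transformation (\<lambda>v. refl_mat u *v v)"
    unfolding orthogonal_transformation_def
    using assms by (auto simp: refl_mat_apply inner_diff_left inner_diff_right norm_eq_1 inner_commute algebra_simps)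
  then show ?thesis
    by (metis matrix_of_matrix_vector_mul orthogonal_transformation_matrix)
qed

lemma refl_mat_swaps:
  fixes a b :: "real ^ 'n"
  assumes "norm a = norm b" "a \<noteq> b"
  shows "refl_mat ((a - b) /\<^sub>R norm (a - b)) *v a = b"
proof -
  have n: "norm (a - b) * norm (a - b) = 2 * ((a - b) \<bullet> a)"
    using assms(1) power2_norm_eq_inner[of "a - b"]
    by (simp add: power2_eq_square norm_eq inner_diff_left inner_diff_right inner_commute)
  have "norm (a - b) \<noteq> 0" using assms(2) by simp
  then have "2 * ((a - b) \<bullet> a) * inverse (norm (a - b)) * inverse (norm (a - b)) = 1"
    unfolding n[symmetric] by (simp add: field_simps)
  moreover have "refl_mat ((a - b) /\<^sub>R norm (a - b)) *v a
      = a - (2 * ((a - b) \<bullet> a) * inverse (norm (a - b)) * inverse (norm (a - b))) *\<^sub>R (a - b)"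
    by (simp add: refl_mat_apply mult_ac)
  ultimately show ?thesis by simp
qed

text \<open>The Cartan--Dieudonne argument: if \<open>A\<close> moves the basis vector \<open>e\<^sub>j\<close>, the reflection in \<open>A e\<^sub>j - e\<^sub>j\<close>
  carries \<open>A e\<^sub>j\<close> back to \<open>e\<^sub>j\<close> and fixes every basis vector fixed by \<open>A\<close>, since those are orthogonal to both.\<close>
lemma orthogonal_eq_product_of_reflections:
  fixes A :: "real ^ 'n ^ 'n"
  assumes "orthogonal_matrix A"
  shows "\<exists>us. (\<forall>u\<in>set us. norm u = 1) \<and> A = foldr (\<lambda>u M. refl_mat u ** M) us (mat 1)"
  using assms
proof (induction "card {i. A *v axis i 1 \<noteq> axis i 1}" arbitrary: A rule: less_induct)
  case less
  let ?I = "\<lambda>A :: real^'n^'n. {i. A *v axis i 1 \<noteq> axis i 1}"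
  have iso: "(A *v x) \<bullet> (A *v y) = x \<bullet> y" for x y
    using orthogonal_matrix_inner[OF less.prems] .
  show ?case
  proof (cases "?I A = {}")
    case True
    then have "column i A = axis i 1" for i
      by (metis (mono_tags, lifting) empty_Collect_eq matrix_vector_mult_basis)
    then have "column i A $ a = axis i 1 $ a" for i a by simp
    then have "A = mat 1"
      by (simp add: vec_eq_iff column_def mat_def axis_def)
    then show ?thesis by (intro exI[of _ "[]"]) simp
  next
    case False
    then obtain j where j: "A *v axis j 1 \<noteq> axis j 1" by auto
    define u where "u = (A *v axis j 1 - axis j 1) /\<^sub>R norm (A *v axis j 1 - axis j 1)"
    have u: "norm u = 1" using j by (simp add: u_def)
    define B where "B = refl_mat u ** A"
    have oB: "orthogonal_matrix B"
      unfolding B_def by (intro orthogonal_matrix_mul orthogonal_refl_mat u less.prems)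
    have nj: "norm (A *v axis j 1) = norm (axis j 1 :: real^'n)"
      unfolding norm_eq using iso by simp
    have Bj: "B *v axis j 1 = axis j 1"
      unfolding B_def u_def by (simp add: matrix_vector_mul_assoc[symmetric] refl_mat_swaps[OF nj j])
    have "B *v axis i 1 = axis i 1" if "A *v axis i 1 = axis i 1" for i
    proof -
      have "u \<bullet> axis i 1 = 0"
        using iso[of "axis j 1" "axis i 1"] that by (simp add: u_def inner_diff_left)
      then show ?thesis
        by (simp add: B_def matrix_vector_mul_assoc[symmetric] that refl_mat_apply)
    qed
    with Bj j have "?I B \<subset> ?I A" by blast
    then have "card (?I B) < card (?I A)" by (intro psubset_card_mono) auto
    from less.hyps[OF this oB] obtain us
      where us: "\<forall>u\<in>set us. norm u = 1" "B = foldr (\<lambda>u M. refl_mat u ** M) us (mat 1)" by blast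
    have "A = refl_mat u ** B"
      by (simp add: B_def matrix_mul_assoc refl_mat_involution[OF u])
    then show ?thesis using us u by (intro exI[of _ "u # us"]) simp
  qed
qed

text \<open>All reflections are conjugate under the orthogonal group, so the determinant can be computed for a
  coordinate reflection.\<close>
lemma det_refl_mat:
  fixes u :: "real ^ 'n"
  assumes "norm u = 1" shows "det (refl_mat u) = -1"
proof -
  fix k :: 'n
  obtain Q :: "real^'n^'n" where Q: "orthogonal_matrix Q" "Q *v axis k 1 = u"
    using orthogonal_matrix_exists_basis[OF assms] by metis
  have "refl_mat u ** Q = Q ** refl_mat (axis k 1)"
  proof (rule matrix_eqI)
    fix v
    have "u \<bullet> (Q *v v) = axis k 1 \<bullet> v"
      using Q orthogonal_matrix_inner by metis
    then show "(refl_mat u ** Q) *v v = (Q ** refl_mat (axis k 1)) *v v"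
      using Q(2) by (simp add: matrix_vector_mul_assoc[symmetric] refl_mat_apply matrix_vector_mult_diff_distrib matrix_vector_mult_scaleR)
  qed
  then have "det (refl_mat u) * det Q = det Q * det (refl_mat (axis k 1 :: real^'n))"
    by (metis det_mul)
  moreover have "det Q \<noteq> 0" using det_orthogonal_matrix[OF Q(1)] by auto
  ultimately have "det (refl_mat u) = det (refl_mat (axis k 1 :: real^'n))" by simp
  also have "refl_mat (axis k 1 :: real^'n) = (\<chi> i j. if i = j then if i = k then -1 else 1 else 0)"
    unfolding refl_mat_def matrix_def by (auto simp: vec_eq_iff inner_axis_axis) (auto simp: axis_def)
  also have "det \<dots> = (\<Prod>i\<in>UNIV. if i = k then -1 else 1)"
    by (subst det_diagonal) auto
  also have "\<dots> = -1" by (simp add: prod.If_cases)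
  finally show ?thesis .
qed

lemma rotation_even_reflections:
  fixes A :: "real ^ 'n ^ 'n"
  assumes "rotation_matrix A"
  shows "\<exists>us. even (length us) \<and> (\<forall>u\<in>set us. norm u = 1) \<and> A = foldr (\<lambda>u M. refl_mat u ** M) us (mat 1)"
proof -
  obtain us where us: "\<forall>u\<in>set us. norm u = 1" "A = foldr (\<lambda>u M. refl_mat u ** M) us (mat 1)"
    using assms orthogonal_eq_product_of_reflections unfolding rotation_matrix_def by blast
  have "det (foldr (\<lambda>u M. refl_mat u ** M) us (mat 1 :: real^'n^'n)) = (-1) ^ length us"
    using us(1) by (induction us) (auto simp: det_mul det_refl_mat)
  then have "even (length us)"
    using assms us(2) unfolding rotation_matrix_def by (cases "even (length us)") auto
  with us show ?thesis by blast
qed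

section \<open>The spin group and the fibres of the Hopf map\<close>

lemma spin_group_isometry:
  assumes "g \<in> spin_group V"
  shows "linear g" "g s \<bullet> g t = s \<bullet> t"
proof -
  have "linear g \<and> (\<forall>s t. g s \<bullet> g t = s \<bullet> t)"
    using assms
  proof induction
    case id
    then show ?case by (simp add: id_def linear_ident)
  next
    case (mult g u w)
    have lin: "linear (clifford v)" for v
      using bilinear_clifford unfolding bilinear_def by blast
    have iso: "clifford v s \<bullet> clifford v t = s \<bullet> t" if "norm v = 1" for v s t
      using that by (simp add: clifford_symmetric clifford_square)
    have lin': "linear (clifford u \<circ> clifford w \<circ> g)"
      using mult lin by (intro linear_compose[of g] linear_compose[of "clifford w"]) auto
    show ?case using mult by (intro conjI allI lin') (simp add: iso)
  qed
  then show "linear g" "g s \<bullet> g t = s \<bullet> t" by auto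
qed

lemma spin_lift_linear:
  assumes "spin_lift_of g A"
  shows "linear g" "g s \<bullet> g t = s \<bullet> t" "norm (g s) = norm s" "surj g" "bij g"
proof -
  have g: "g \<in> spin_group UNIV" using assms unfolding spin_lift_of_def Spin9_def by simp
  show l: "linear g" and i: "g s \<bullet> g t = s \<bullet> t" using spin_group_isometry[OF g] by auto
  show "norm (g s) = norm s" using spin_group_isometry(2)[OF g] by (simp add: norm_eq)
  have "inj g"
    using spin_group_isometry(2)[OF g] by (intro linear_injective_0[OF l, THEN iffD2]) (metis inner_eq_zero_iff)
  then show "surj g" "bij g"
    using linear_injective_imp_surjective[OF l] by (auto simp: bij_def)
qed

text \<open>Equivariance: \<open>\<langle>h(g s), A w\<rangle> = \<langle>g s, (A w) g s\<rangle> = \<langle>g s, g (w s)\<rangle> = \<langle>s, w s\<rangle> = \<langle>h s, w\<rangle>\<close>.\<close>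
lemma spin_lift_hopf_map:
  assumes "spin_lift_of g A" "orthogonal_matrix A"
  shows "hopf_map (g s) = A *v hopf_map s"
proof (rule vector_eq_rdot[THEN iffD1], intro allI)
  fix v
  define w where "w = transpose A *v v"
  have v: "v = A *v w"
    using assms(2) unfolding w_def matrix_vector_mul_assoc orthogonal_matrix_def
    by (metis matrix_vector_mul_lid)
  have "hopf_map (g s) \<bullet> v = g s \<bullet> (clifford (A *v w) \<circ> g) s"
    by (simp add: inner_hopf_map v)
  also have "\<dots> = g s \<bullet> g (clifford w s)"
    using assms(1) unfolding spin_lift_of_def by (metis comp_apply)
  also have "\<dots> = hopf_map s \<bullet> w"
    by (simp add: spin_lift_linear(2)[OF assms(1)] inner_hopf_map)
  finally show "hopf_map (g s) \<bullet> v = (A *v hopf_map s) \<bullet> v"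
    by (simp add: v orthogonal_matrix_inner[OF assms(2)])
qed

text \<open>Conjugation by a unit vector is minus the reflection in it; the sign disappears in products of
  two.\<close>
lemma clifford_twisted_conjugation:
  assumes "norm u = 1"
  shows "clifford u (clifford v s) = clifford (- (refl_mat u *v v)) (clifford u s)"
proof -
  have "clifford u (clifford v s) = (2 * (u \<bullet> v)) *\<^sub>R s - clifford v (clifford u s)"
    using clifford_anticommute[of u v s] by (simp add: algebra_simps)
  also have "\<dots> = clifford ((2 * (u \<bullet> v)) *\<^sub>R u - v) (clifford u s)"
    using assms by (simp add: clifford_diff_left clifford_scaleR_left clifford_square)
  finally show ?thesis by (simp add: refl_mat_apply)
qed

lemma spin_lift_step:
  assumes "spin_lift_of g A" "norm u = 1" "norm w = 1"
  shows "spin_lift_of (clifford u \<circ> clifford w \<circ> g) (refl_mat u ** (refl_mat w ** A))"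
  unfolding spin_lift_of_def
proof (intro conjI allI ext)
  show "clifford u \<circ> clifford w \<circ> g \<in> Spin9"
    using assms unfolding spin_lift_of_def Spin9_def by (intro spin_group.mult) auto
  fix v s
  have "g (clifford v s) = clifford (A *v v) (g s)"
    using assms(1) unfolding spin_lift_of_def by (metis comp_apply)
  then have "(clifford u \<circ> clifford w \<circ> g \<circ> clifford v) s
      = clifford (- (refl_mat u *v (- (refl_mat w *v (A *v v))))) ((clifford u \<circ> clifford w \<circ> g) s)"
    by (simp add: clifford_twisted_conjugation[OF assms(3)] clifford_twisted_conjugation[OF assms(2)])
  also have "- (refl_mat u *v (- (refl_mat w *v (A *v v)))) = (refl_mat u ** (refl_mat w ** A)) *v v"
    by (simp add: matrix_vector_mul_assoc[symmetric] linear_neg[OF matrix_vector_mul_linear])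
  finally show "(clifford u \<circ> clifford w \<circ> g \<circ> clifford v) s
      = (clifford ((refl_mat u ** (refl_mat w ** A)) *v v) \<circ> (clifford u \<circ> clifford w \<circ> g)) s"
    by simp
qed

lemma spin_lift_id: "spin_lift_of id (mat 1)"
  by (simp add: spin_lift_of_def Spin9_def spin_group.id)

text \<open>A rotation has determinant 1, so the number of reflections is even and they can be grouped into the pairs that
  generate the spin group.\<close>
lemma rotation_has_spin_lift:
  assumes "rotation_matrix A"
  shows "\<exists>g. spin_lift_of g A"
proof -
  have "\<exists>g. spin_lift_of g (foldr (\<lambda>u M. refl_mat u ** M) us (mat 1))"
    if "even (length us)" "\<forall>u\<in>set us. norm u = 1" for us
    using that
  proof (induction "length us" arbitrary: us rule: less_induct)
    case less
    show ?case
    proof (cases us)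
      case Nil
      then show ?thesis using spin_lift_id by auto
    next
      case (Cons u vs)
      then obtain w ws where "us = u # w # ws" using less.prems(1) by (cases vs) auto
      then show ?thesis using less.hyps[of ws] less.prems spin_lift_step by fastforce
    qed
  qed
  then show ?thesis using rotation_even_reflections[OF assms] by metis
qed

lemma Spin9_covers_orthogonal:
  assumes "g \<in> Spin9"
  shows "\<exists>A. orthogonal_matrix A \<and> spin_lift_of g A"
  using assms unfolding Spin9_def
proof induction
  case id
  then show ?case using spin_lift_id orthogonal_matrix_id by blast
next
  case (mult g u w)
  then show ?case
    using spin_lift_step[of g _ u w] by (metis orthogonal_matrix_mul orthogonal_refl_mat)
qed

lemma spin_lift_image_fibre:
  assumes "spin_lift_of g A" "orthogonal_matrix A"
  shows "g ` (hopf_map -` {w}) = hopf_map -` {A *v w}"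
proof (intro equalityI subsetI)
  fix y assume y: "y \<in> hopf_map -` {A *v w}"
  obtain z where z: "y = g z" using spin_lift_linear(4)[OF assms(1)] by (metis surjD)
  have "A *v hopf_map z = A *v w" using y z spin_lift_hopf_map[OF assms] by simp
  then have "hopf_map z = w"
    using assms(2) by (metis matrix_vector_mul_assoc matrix_vector_mul_lid orthogonal_matrix_def)
  then show "y \<in> g ` (hopf_map -` {w})" using z by auto
qed (auto simp: spin_lift_hopf_map[OF assms])

lemma SO9_act_fibre:
  assumes "rotation_matrix A"
  shows "SO9_act A (hopf_map -` {w}) = hopf_map -` {A *v w}"
proof -
  have o: "orthogonal_matrix A" using assms rotation_matrix_def by blast
  have "SO9_act A (hopf_map -` {w}) = (\<Union>g\<in>{g. spin_lift_of g A}. g ` (hopf_map -` {w}))"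
    unfolding SO9_act_def by blast
  also have "\<dots> = hopf_map -` {A *v w}"
    using spin_lift_image_fibre[OF _ o] rotation_has_spin_lift[OF assms] by auto
  finally show ?thesis .
qed

lemma hopf_map_fibre_base: "hopf_map -` {axis 1 1} = {(x, 0) | x. norm x = 1}"
proof (intro equalityI subsetI)
  fix s assume "s \<in> hopf_map -` {axis 1 1}"
  then have s: "hopf_map s = axis 1 1" by simp
  obtain x y where xy: "s = (x, y)" by (metis surj_pair)
  have "(norm x)\<^sup>2 - (norm y)\<^sup>2 = 1"
    using arg_cong[OF s, of "\<lambda>v. v $ 1"] unfolding xy hopf_map_components vec9_1
    by (simp add: axis_def)
  moreover have "(norm x)\<^sup>2 + (norm y)\<^sup>2 = 1"
    using norm_hopf_map[of s] s by (simp add: xy norm_Pair)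
  ultimately have "(norm y)\<^sup>2 = 0" "(norm x)\<^sup>2 = 1" by linarith+
  then have "y = 0" "(norm x)\<^sup>2 = 1" by auto
  then show "s \<in> {(x, 0) | x. norm x = 1}" using xy norm_ge_zero[of x] unfolding power2_eq_1_iff by auto
next
  fix s :: "octonion \<times> octonion" assume "s \<in> {(x, 0) | x. norm x = 1}"
  then obtain x where s: "s = (x, 0)" "norm x = 1" by blast
  have "clifford (axis 1 1) s = s"
    by (simp add: s(1) oct_part_axis_1)
  then show "s \<in> hopf_map -` {axis 1 1}"
    using s by (simp add: hopf_map_eq_iff norm_Pair)
qed

text \<open>Vectors with vanishing first coordinate exchange the two half-spinor spaces, so pairs of them preserve the
  first one. Conversely \<open>p\<close> following \<open>1\<close> sends \<open>(1, 0)\<close> first to \<open>(0, 1)\<close> and then to \<open>(p, 0)\<close>.\<close>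
lemma Spin8_orbit_base: "{h hopf_base | h. h \<in> Spin8} = {(x, 0) | x. norm x = 1}"
proof (intro equalityI subsetI)
  fix s assume "s \<in> {h hopf_base | h. h \<in> Spin8}"
  then obtain h where h: "h \<in> Spin8" "s = h hopf_base" by blast
  have "\<exists>x. h hopf_base = (x, 0) \<and> norm (h hopf_base) = 1"
    using h(1) unfolding Spin8_def
  proof induction
    case id
    then show ?case by (simp add: hopf_base_def norm_Pair)
  next
    case (mult g u w)
    then obtain x where x: "g hopf_base = (x, 0)" "norm (g hopf_base) = 1" by blast
    have "norm ((clifford u \<circ> clifford w \<circ> g) hopf_base) = 1"
      using mult x by (simp add: norm_clifford del: clifford.simps)
    moreover have "snd ((clifford u \<circ> clifford w \<circ> g) hopf_base) = 0"
      using mult x by simp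
    ultimately show ?case by (metis prod.collapse)
  qed
  then show "s \<in> {(x, 0) | x. norm x = 1}" using h(2) by (auto simp: norm_Pair)
next
  fix s :: "octonion \<times> octonion" assume "s \<in> {(x, 0) | x. norm x = 1}"
  then obtain x where s: "s = (x, 0)" "norm x = 1" by blast
  define u where "u = vec9 0 x"
  define w where "w = vec9 0 oct_one"
  have n: "norm (vec9 0 p) = norm p" for p
    by (rule power2_eq_imp_eq) (simp_all add: norm_oct_part)
  have "clifford u \<circ> clifford w \<circ> id \<in> Spin8"
    unfolding Spin8_def
    by (rule spin_group.mult) (auto intro: spin_group.id simp: u_def w_def n s norm_Pair)
  moreover have "(clifford u \<circ> clifford w \<circ> id) hopf_base = s"
    by (simp add: u_def w_def hopf_base_def s) (simp add: zero_prod_def[symmetric])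
  ultimately show "s \<in> {h hopf_base | h. h \<in> Spin8}"
    by (metis (mono_tags, lifting) mem_Collect_eq)
qed

lemma hopf_fibre_eq_vimage:
  assumes "spin_lift_of g A" "orthogonal_matrix A"
  shows "hopf_fibre g = hopf_map -` {A *v axis 1 1}"
proof -
  have "hopf_fibre g = g ` {h hopf_base | h. h \<in> Spin8}"
    unfolding hopf_fibre_def by auto
  then show ?thesis
    unfolding Spin8_orbit_base hopf_map_fibre_base[symmetric]
    using spin_lift_image_fibre[OF assms] by simp
qed

lemma scale_fibre:
  assumes "r > 0"
  shows "(\<lambda>x. r *\<^sub>R x) ` (hopf_map -` {w}) = hopf_map -` {r\<^sup>2 *\<^sub>R w}"
proof (intro equalityI subsetI)
  fix y assume "y \<in> hopf_map -` {r\<^sup>2 *\<^sub>R w}"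
  then have "hopf_map (inverse r *\<^sub>R y) = w"
    using assms by (simp add: hopf_map_scaleR power_inverse)
  then show "y \<in> (\<lambda>x. r *\<^sub>R x) ` (hopf_map -` {w})"
    using assms by (intro image_eqI[of _ _ "inverse r *\<^sub>R y"]) auto
next
  fix y assume "y \<in> (\<lambda>x. r *\<^sub>R x) ` (hopf_map -` {w})"
  then obtain s where "y = r *\<^sub>R s" "hopf_map s = w" by blast
  then show "y \<in> hopf_map -` {r\<^sup>2 *\<^sub>R w}" by (simp add: hopf_map_scaleR)
qed

lemma rotation_to_unit:
  fixes w :: "real ^ 9"
  assumes "norm w = 1"
  shows "\<exists>A. rotation_matrix A \<and> A *v axis 1 1 = w"
proof -
  have "2 \<le> CARD(9)" by simp
  then obtain A :: "real^9^9" where "rotation_matrix A" "A *v axis 1 1 = w"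
    using rotation_matrix_exists_basis[of w 1] assms by metis
  then show ?thesis by blast
qed

text \<open>Each \<open>g \<in> Spin(9)\<close> carries the fibre over the first basis vector to another fibre, and the
  scaling by \<open>r\<close> multiplies \<open>h\<close> by \<open>r\<^sup>2\<close>. All nonzero values occur because rotations act transitively on
  the unit sphere and lift to \<open>Spin(9)\<close>.\<close>
lemma hopf_foliation_eq: "hopf_foliation = range (\<lambda>w. hopf_map -` {w})"
proof (intro equalityI subsetI)
  fix L assume "L \<in> hopf_foliation"
  then consider "L = {0}" | r g where "r > 0" "g \<in> Spin9" "L = (\<lambda>x. r *\<^sub>R x) ` hopf_fibre g"
    unfolding hopf_foliation_def by blast
  then show "L \<in> range (\<lambda>w. hopf_map -` {w})"
  proof cases
    case 1
    then have "L = hopf_map -` {0}" by auto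
    then show ?thesis by blast
  next
    case 2
    then show ?thesis using Spin9_covers_orthogonal[OF 2(2)] hopf_fibre_eq_vimage scale_fibre by auto
  qed
next
  fix L assume "L \<in> range (\<lambda>w. hopf_map -` {w})"
  then obtain w where L: "L = hopf_map -` {w}" by blast
  show "L \<in> hopf_foliation"
  proof (cases "w = 0")
    case True
    then have "L = {0}" using L by auto
    then show ?thesis unfolding hopf_foliation_def by simp
  next
    case False
    obtain A where A: "rotation_matrix A" "A *v axis 1 1 = w /\<^sub>R norm w"
      using rotation_to_unit[of "w /\<^sub>R norm w"] False by auto
    obtain g where g: "spin_lift_of g A" using rotation_has_spin_lift[OF A(1)] by blast
    have "hopf_fibre g = hopf_map -` {w /\<^sub>R norm w}"
      using hopf_fibre_eq_vimage[OF g] A unfolding rotation_matrix_def by simp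
    then have "L = (\<lambda>x. sqrt (norm w) *\<^sub>R x) ` hopf_fibre g"
      using False L by (simp add: scale_fibre)
    moreover have "g \<in> Spin9" using g unfolding spin_lift_of_def by blast
    ultimately show ?thesis unfolding hopf_foliation_def using False by (metis (mono_tags, lifting) insertI2 mem_Collect_eq real_sqrt_gt_zero zero_less_norm_iff)
  qed
qed

lemma leaf_through_hopf: "leaf_through hopf_foliation x = hopf_map -` {hopf_map x}"
  unfolding leaf_through_def hopf_foliation_eq by (rule the_equality) auto

lemma surj_hopf_map: "\<exists>x. hopf_map x = w"
proof -
  obtain x :: octonion where "norm x = 1" using vector_choose_size[of 1] zero_le_one by blast
  then have "hopf_map -` {axis 1 1} \<noteq> {}"
    unfolding hopf_map_fibre_base by blast
  then obtain s where s: "hopf_map s = axis 1 1" by blast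
  show ?thesis
  proof (cases "w = 0")
    case True
    then show ?thesis using hopf_map_0 by blast
  next
    case False
    obtain A where A: "rotation_matrix A" "A *v axis 1 1 = w /\<^sub>R norm w"
      using rotation_to_unit[of "w /\<^sub>R norm w"] False by auto
    obtain g where g: "spin_lift_of g A" using rotation_has_spin_lift[OF A(1)] by blast
    have "hopf_map (sqrt (norm w) *\<^sub>R g s) = w"
      using spin_lift_hopf_map[OF g] A s False unfolding rotation_matrix_def by (simp add: hopf_map_scaleR)
    then show ?thesis by blast
  qed
qed

section \<open>Half-spinors and the inversion of the Hopf map\<close>

lemma hopf_polar_add_left: "hopf_polar (s + s') t = hopf_polar s t + hopf_polar s' t"
  and hopf_polar_add_right: "hopf_polar s (t + t') = hopf_polar s t + hopf_polar s t'"
  and hopf_polar_scaleR_left: "hopf_polar (r *\<^sub>R s) t = r *\<^sub>R hopf_polar s t"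
  and hopf_polar_scaleR_right: "hopf_polar s (r *\<^sub>R t) = r *\<^sub>R hopf_polar s t"
  by (simp_all add: hopf_polar_def vec_eq_iff inner_add_left inner_add_right clifford_add_right clifford_scaleR_right)

lemma bounded_bilinear_hopf_polar: "bounded_bilinear hopf_polar"
  unfolding bilinear_conv_bounded_bilinear[symmetric] bilinear_def
  by (intro conjI allI linearI hopf_polar_add_left hopf_polar_add_right hopf_polar_scaleR_left
      hopf_polar_scaleR_right)

lemma bounded_linear_hopf_polar: "bounded_linear (hopf_polar s)"
  by (rule bounded_bilinear.bounded_linear_right[OF bounded_bilinear_hopf_polar])

lemmas hopf_polar_diff_right = linear_diff[OF bounded_linear.linear[OF bounded_linear_hopf_polar]]

lemma bounded_bilinear_matrix_vector_mult:
  "bounded_bilinear ((*v) :: real ^ 'n ^ 'm \<Rightarrow> real ^ 'n \<Rightarrow> real ^ 'm)"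
  unfolding bilinear_conv_bounded_bilinear[symmetric] bilinear_def
  by (intro conjI allI linearI matrix_vector_mult_add_rdistrib matrix_vector_right_distrib
      matrix_vector_mult_scaleR scaleR_matrix_vector_assoc[symmetric])

lemma bounded_linear_transpose: "bounded_linear (transpose :: real ^ 'n ^ 'm \<Rightarrow> real ^ 'm ^ 'n)"
  unfolding linear_conv_bounded_linear[symmetric]
  by (intro linearI) (simp_all add: transpose_def vec_eq_iff)

lemmas Ck_on_clifford [Ck_intros] = Ck_on_bilinear[OF _ bounded_bilinear_clifford]
lemmas Ck_on_hopf_polar [Ck_intros] = Ck_on_bilinear[OF _ bounded_bilinear_hopf_polar]
lemmas Ck_on_matrix_vector_mult [Ck_intros] = Ck_on_bilinear[OF _ bounded_bilinear_matrix_vector_mult]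
lemmas Ck_on_transpose [Ck_intros] = Ck_on_linear_comp[OF _ bounded_linear_transpose]

lemma Ck_on_hopf_map [Ck_intros]:
  "open S \<Longrightarrow> Ck_on n S f \<Longrightarrow> Ck_on n S (\<lambda>x. hopf_map (f x))"
  unfolding hopf_map_polar by (rule Ck_on_hopf_polar)

text \<open>For a unit vector \<open>e\<close> this is the orthogonal projection onto the \<open>+1\<close> eigenspace of Clifford multiplication
  by \<open>e\<close>.\<close>
definition half_spinor :: "real ^ 9 \<Rightarrow> octonion \<times> octonion \<Rightarrow> octonion \<times> octonion"
  where "half_spinor e s = (1/2) *\<^sub>R (s + clifford e s)"

lemma hopf_polar_clifford:
  assumes "norm c = 1" shows "hopf_polar c (clifford v c) = v"
proof (rule vector_eq_rdot[THEN iffD1], intro allI)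
  fix x
  have "c \<bullet> (clifford x (clifford v c) + clifford v (clifford x c)) = 2 * (x \<bullet> v)"
    unfolding clifford_anticommute using assms by (simp add: norm_eq_1)
  moreover have "c \<bullet> clifford x (clifford v c) = c \<bullet> clifford v (clifford x c)"
    by (metis clifford_symmetric inner_commute)
  ultimately show "hopf_polar c (clifford v c) \<bullet> x = v \<bullet> x"
    unfolding inner_hopf_polar by (simp add: inner_add_right inner_commute)
qed

text \<open>A vector \<open>v\<close> orthogonal to \<open>e\<close> anticommutes with \<open>e\<close> and so maps the \<open>+1\<close> eigenspace into the \<open>-1\<close>
  eigenspace, which is orthogonal to \<open>c\<close>; only the component of \<open>v\<close> along \<open>e\<close> contributes.\<close>
lemma hopf_polar_half_spinor:
  assumes "clifford e t = t" and c: "clifford e c = c"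
  shows "hopf_polar c t = (c \<bullet> t) *\<^sub>R e"
proof (rule vector_eq_rdot[THEN iffD1], intro allI)
  fix v
  have "c \<bullet> (clifford e (clifford v t) + clifford v (clifford e t)) = 2 * (e \<bullet> v) * (c \<bullet> t)"
    unfolding clifford_anticommute by simp
  moreover have "c \<bullet> clifford e (clifford v t) = c \<bullet> clifford v t"
    using clifford_symmetric[of e c] c by metis
  ultimately show "hopf_polar c t \<bullet> v = ((c \<bullet> t) *\<^sub>R e) \<bullet> v"
    by (simp add: inner_hopf_polar assms inner_add_right)
qed

lemma clifford_diff_right: "clifford v (s - t) = clifford v s - clifford v t"
  using linear_diff[of "clifford v"] bilinear_clifford unfolding bilinear_def by blast

lemma clifford_half_spinor:
  assumes "norm e = 1" shows "clifford e (half_spinor e s) = half_spinor e s"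
  using assms by (simp add: half_spinor_def clifford_scaleR_right clifford_add_right clifford_square add.commute)

lemma inner_half_spinor:
  assumes "clifford e c = c" shows "half_spinor e s \<bullet> c = s \<bullet> c"
  using assms by (simp add: half_spinor_def inner_add_left clifford_symmetric)

lemma clifford_hopf_map_unit:
  assumes "norm c = 1"
  shows "clifford (hopf_map c) c = c" "norm (hopf_map c) = 1"
  using hopf_map_eq_iff[of c "hopf_map c"] assms by (auto simp: norm_hopf_map)

text \<open>The spinors \<open>u c\<close> with \<open>u \<in> \<real>\<^sup>9\<close> span \<open>c\<close> and the \<open>-1\<close> eigenspace of \<open>h c\<close>. Subtracting from \<open>z\<close> its
  component \<open>u c\<close> therefore leaves a vector of the \<open>+1\<close> eigenspace orthogonal to \<open>c\<close>, to which \<open>c\<close> itself is added.\<close>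
definition chart_spinor :: "octonion \<times> octonion \<Rightarrow> octonion \<times> octonion \<Rightarrow> octonion \<times> octonion"
  where "chart_spinor c z = c + z - clifford (hopf_polar c z) c"

lemma chart_spinor:
  assumes c: "norm c = 1"
  shows "clifford (hopf_map c) (chart_spinor c z) = chart_spinor c z"
    "chart_spinor c z \<bullet> c = 1"
proof -
  let ?e = "hopf_map c"
  note e = clifford_hopf_map_unit[OF c]
  define zp where "zp = half_spinor ?e z"
  define zm where "zm = z - zp"
  have zp: "clifford ?e zp = zp" unfolding zp_def by (rule clifford_half_spinor[OF e(2)])
  have "2 *\<^sub>R zp = z + clifford ?e z" by (simp add: zp_def half_spinor_def)
  then have "clifford ?e z = zp + zp - z" by (simp add: scaleR_2)
  then have "clifford ?e zm = - zm"
    unfolding zm_def by (simp add: clifford_diff_right zp)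
  then have "clifford (hopf_polar c zm) c = zm" by (rule clifford_hopf_polar[OF c])
  moreover have "hopf_polar c z = hopf_polar c zm + (c \<bullet> zp) *\<^sub>R ?e"
    using hopf_polar_half_spinor[OF zp e(1)] hopf_polar_add_right[of c zm zp] by (simp add: zm_def)
  ultimately have "clifford (hopf_polar c z) c = zm + (c \<bullet> zp) *\<^sub>R c"
    by (simp add: clifford_add_left clifford_scaleR_left e)
  then have eta: "chart_spinor c z = c + zp - (c \<bullet> zp) *\<^sub>R c"
    by (simp add: chart_spinor_def zm_def)
  then show "clifford ?e (chart_spinor c z) = chart_spinor c z"
    by (simp add: clifford_diff_right clifford_add_right clifford_scaleR_right zp e)
  show "chart_spinor c z \<bullet> c = 1"
    unfolding eta using c by (simp add: inner_diff_left inner_add_left norm_eq_1 inner_commute[of zp c])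
qed

text \<open>Up to a factor the projection of \<open>\<eta>\<close> onto the eigenspace of \<open>w\<close> with eigenvalue \<open>\<bar>w\<bar>\<close>, which up to
  scaling is the fibre over \<open>w\<close>.\<close>
definition lift_spinor :: "real ^ 9 \<Rightarrow> octonion \<times> octonion \<Rightarrow> octonion \<times> octonion"
  where "lift_spinor w \<eta> = norm w *\<^sub>R \<eta> + clifford w \<eta>"

lemma scaleR_double: "(2 * r) *\<^sub>R x = r *\<^sub>R x + r *\<^sub>R x"
  for x :: "'a::real_vector"
  by (metis mult_2 scaleR_add_left)

lemma hopf_map_half_spinor:
  assumes "norm e = 1" "clifford e \<eta> = \<eta>"
  shows "hopf_map \<eta> = (norm \<eta>)\<^sup>2 *\<^sub>R e"
  unfolding hopf_map_eq_iff using assms by (simp add: clifford_scaleR_left)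

lemma lift_spinor_scaleR: "lift_spinor w (r *\<^sub>R \<eta>) = r *\<^sub>R lift_spinor w \<eta>"
  by (simp add: lift_spinor_def clifford_scaleR_right scaleR_add_right mult.commute)

text \<open>The positive eigenspaces of \<open>w\<close> and \<open>e\<close> are identified by \<^const>\<open>lift_spinor\<close> in one direction and by
  the orthogonal projection in the other, up to the factor \<open>\<bar>w\<bar> + \<langle>w, e\<rangle>\<close>; for \<open>w \<noteq> 0\<close> they are
  orthogonal precisely when it vanishes.\<close>
lemma lift_spinor:
  assumes e: "norm e = 1" and eta: "clifford e \<eta> = \<eta>" and m: "norm w + w \<bullet> e > 0"
  shows "hopf_map (lift_spinor w \<eta>) = (2 * (norm w + w \<bullet> e) * (norm \<eta>)\<^sup>2) *\<^sub>R w"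
    "half_spinor e (lift_spinor w \<eta>) = (norm w + w \<bullet> e) *\<^sub>R \<eta>"
proof -
  let ?m = "norm w + w \<bullet> e"
  have inn: "\<eta> \<bullet> clifford w \<eta> = (norm \<eta>)\<^sup>2 * (w \<bullet> e)"
    using inner_hopf_map[of \<eta> w] hopf_map_half_spinor[OF e eta] by (simp add: inner_commute)
  have "(norm (lift_spinor w \<eta>))\<^sup>2 = 2 * ?m * (norm \<eta>)\<^sup>2 * norm w"
    unfolding lift_spinor_def power2_norm_eq_inner
    by (simp add: inner_add_left inner_add_right clifford_symmetric clifford_square inn)
      (simp add: power2_norm_eq_inner[symmetric] power2_eq_square algebra_simps)
  moreover have "clifford w (lift_spinor w \<eta>) = norm w *\<^sub>R lift_spinor w \<eta>"
    by (simp add: lift_spinor_def clifford_add_right clifford_scaleR_right clifford_square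
        scaleR_add_right power2_eq_square)
  ultimately show "hopf_map (lift_spinor w \<eta>) = (2 * ?m * (norm \<eta>)\<^sup>2) *\<^sub>R w"
    unfolding hopf_map_eq_iff using m by (simp add: clifford_scaleR_left abs_mult)
  have "clifford e (clifford w \<eta>) = (2 * (e \<bullet> w)) *\<^sub>R \<eta> - clifford w \<eta>"
    using clifford_anticommute[of e w \<eta>] eta by (simp add: algebra_simps)
  then have "2 *\<^sub>R half_spinor e (lift_spinor w \<eta>) = (2 * ?m) *\<^sub>R \<eta>"
    by (simp add: half_spinor_def lift_spinor_def clifford_add_right clifford_scaleR_right eta
        inner_commute scaleR_add_left scaleR_2 scaleR_double ring_distribs)
  then have "2 *\<^sub>R half_spinor e (lift_spinor w \<eta>) = 2 *\<^sub>R (?m *\<^sub>R \<eta>)" by simp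
  then show "half_spinor e (lift_spinor w \<eta>) = ?m *\<^sub>R \<eta>"
    unfolding real_vector.scale_cancel_left by simp
qed

text \<open>The composition in the other order, starting from a spinor over \<open>w\<close>.\<close>
lemma lift_half_spinor:
  assumes e: "norm e = 1" and w: "hopf_map s = w"
  shows "lift_spinor w (half_spinor e s) = (norm w + w \<bullet> e) *\<^sub>R s"
    "(norm (half_spinor e s))\<^sup>2 = (norm w + w \<bullet> e) / 2"
proof -
  have cw: "clifford w s = norm w *\<^sub>R s" and n: "(norm s)\<^sup>2 = norm w"
    using w hopf_map_eq_iff by auto
  have "clifford w (clifford e s) = (2 * (w \<bullet> e)) *\<^sub>R s - norm w *\<^sub>R clifford e s"
    using clifford_anticommute[of w e s] by (simp add: cw clifford_scaleR_right algebra_simps)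
  then have "2 *\<^sub>R lift_spinor w (half_spinor e s) = 2 *\<^sub>R ((norm w + w \<bullet> e) *\<^sub>R s)"
    by (simp add: half_spinor_def lift_spinor_def clifford_add_right clifford_scaleR_right cw
        scaleR_add_left scaleR_add_right scaleR_2 scaleR_double ring_distribs)
  then show "lift_spinor w (half_spinor e s) = (norm w + w \<bullet> e) *\<^sub>R s"
    unfolding real_vector.scale_cancel_left by simp
  have "s \<bullet> clifford e s = w \<bullet> e" using inner_hopf_map[of s e] w by simp
  then show "(norm (half_spinor e s))\<^sup>2 = (norm w + w \<bullet> e) / 2"
    unfolding half_spinor_def power2_norm_eq_inner using e n
    by (simp add: inner_add_left inner_add_right clifford_symmetric clifford_square power2_norm_eq_inner)
      (simp add: field_simps)
qed

section \<open>Charts that straighten the twisted leaves\<close>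

text \<open>The local geometry of the leaves uses only that the twist is a smooth family of orthogonal matrices. The
  twisted leaves are the fibres of \<open>leaf_map\<close>.\<close>
locale twisted_hopf =
  fixes A :: "'b::euclidean_space \<Rightarrow> real ^ 9 ^ 9"
  assumes orth: "orthogonal_matrix (A v)" and smooth: "Ck_on n UNIV A"
begin

definition leaf_map :: "'b \<times> (octonion \<times> octonion) \<Rightarrow> real ^ 9"
  where "leaf_map p = transpose (A (fst p)) *v hopf_map (snd p)"

lemma A_transpose [simp]: "A v *v (transpose (A v) *v w) = w" "transpose (A v) *v (A v *v w) = w"
  "A v *v (w v* A v) = w" "(A v *v w) v* A v = w"
  using orth[of v] unfolding transpose_matrix_vector[symmetric] matrix_vector_mul_assoc orthogonal_matrix_def
  by simp_all

lemma leaf_map_eq_iff: "leaf_map p = w \<longleftrightarrow> hopf_map (snd p) = A (fst p) *v w"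
  unfolding leaf_map_def by (metis A_transpose)

lemma norm_A: "norm (A v *v w) = norm w"
  by (simp add: norm_eq orthogonal_matrix_inner[OF orth])

lemma norm_leaf_map: "norm (leaf_map p) = (norm (snd p))\<^sup>2"
  by (metis leaf_map_eq_iff norm_A norm_hopf_map)

definition chart_dom :: "octonion \<times> octonion \<Rightarrow> ('b \<times> (octonion \<times> octonion)) set"
  where "chart_dom c = {p. snd p \<bullet> c > 0}"

text \<open>Since \<open>u \<mapsto> u c\<close> is an isometric embedding of \<open>\<real>\<^sup>9\<close> whose image is the sum of \<open>\<real> c\<close> and the \<open>-1\<close>
  eigenspace of \<open>e = h c\<close>, the spinor component of the chart records two independent data: the value of
  \<^term>\<open>leaf_map\<close>, relative to \<open>w0\<close>, and the direction of the \<open>+1\<close> component of the spinor in gnomonic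
  coordinates, that is, normalised to have inner product 1 with \<open>c\<close> and translated into the orthogonal
  complement of \<open>c\<close>.\<close>
definition chart :: "octonion \<times> octonion \<Rightarrow> real ^ 9 \<Rightarrow> 'b \<times> (octonion \<times> octonion) \<Rightarrow> 'b \<times> (octonion \<times> octonion)"
  where "chart c w0 p = (fst p, clifford (leaf_map p - w0) c +
           inverse (snd p \<bullet> c) *\<^sub>R half_spinor (hopf_map c) (snd p) - c)"

text \<open>The value that the Hopf map must take at the spinor with chart coordinates \<open>q\<close>.\<close>
definition chart_base :: "octonion \<times> octonion \<Rightarrow> real ^ 9 \<Rightarrow> 'b \<times> (octonion \<times> octonion) \<Rightarrow> real ^ 9"
  where "chart_base c w0 q = A (fst q) *v (w0 + hopf_polar c (snd q))"

definition chart_height :: "octonion \<times> octonion \<Rightarrow> real ^ 9 \<Rightarrow> 'b \<times> (octonion \<times> octonion) \<Rightarrow> real"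
  where "chart_height c w0 q = norm (chart_base c w0 q) + chart_base c w0 q \<bullet> hopf_map c"

definition chart_ran :: "octonion \<times> octonion \<Rightarrow> real ^ 9 \<Rightarrow> ('b \<times> (octonion \<times> octonion)) set"
  where "chart_ran c w0 = {q. chart_height c w0 q > 0}"

text \<open>The factor makes the Hopf map equal to \<open>chart_base\<close>, by the formula in \<open>lift_spinor\<close>.\<close>
definition chart_inv :: "octonion \<times> octonion \<Rightarrow> real ^ 9 \<Rightarrow> 'b \<times> (octonion \<times> octonion) \<Rightarrow> 'b \<times> (octonion \<times> octonion)"
  where "chart_inv c w0 q = (fst q,
    inverse (sqrt (2 * chart_height c w0 q) * norm (chart_spinor c (snd q))) *\<^sub>R
      lift_spinor (chart_base c w0 q) (chart_spinor c (snd q)))"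

text \<open>In the chart \<^term>\<open>leaf_map\<close> becomes the linear map \<open>hopf_polar c \<circ> snd\<close>, up to the constant \<open>w0\<close>.\<close>
lemma hopf_polar_chart:
  assumes c: "norm c = 1" and p: "p \<in> chart_dom c"
  shows "hopf_polar c (snd (chart c w0 p)) = leaf_map p - w0"
proof -
  note e = clifford_hopf_map_unit[OF c]
  have "hopf_polar c (half_spinor (hopf_map c) (snd p)) = (snd p \<bullet> c) *\<^sub>R hopf_map c"
    using hopf_polar_half_spinor[OF clifford_half_spinor[OF e(2)] e(1)]
    by (simp add: inner_commute[of c] inner_half_spinor[OF e(1)])
  then show ?thesis
    using p by (simp add: chart_def chart_dom_def hopf_polar_diff_right hopf_polar_add_right
        hopf_polar_scaleR_right hopf_polar_clifford[OF c] hopf_map_polar[symmetric])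
qed

lemma chart_base_chart:
  assumes c: "norm c = 1" and p: "p \<in> chart_dom c"
  shows "chart_base c w0 (chart c w0 p) = hopf_map (snd p)"
proof -
  have "fst (chart c w0 p) = fst p" by (simp add: chart_def)
  then show ?thesis
    unfolding chart_base_def hopf_polar_chart[OF assms] by (simp add: leaf_map_def)
qed

lemma chart_in_ran:
  assumes c: "norm c = 1" and p: "p \<in> chart_dom c"
  shows "chart c w0 p \<in> chart_ran c w0"
proof -
  note e = clifford_hopf_map_unit[OF c]
  have "half_spinor (hopf_map c) (snd p) \<noteq> 0"
    using p inner_half_spinor[OF e(1), of "snd p"] by (auto simp: chart_dom_def)
  then have "(norm (half_spinor (hopf_map c) (snd p)))\<^sup>2 > 0" by simp
  then show ?thesis
    using lift_half_spinor(2)[OF e(2) refl, of "snd p"]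
    by (simp add: chart_ran_def chart_height_def chart_base_chart[OF assms])
qed

lemma chart_inv_chart:
  assumes c: "norm c = 1" and p: "p \<in> chart_dom c"
  shows "chart_inv c w0 (chart c w0 p) = p"
proof -
  note e = clifford_hopf_map_unit[OF c]
  obtain v s where vs: "p = (v, s)" by fastforce
  let ?q = "chart c w0 p" and ?h = "half_spinor (hopf_map c) s" and ?w = "hopf_map s"
  define m where "m = norm ?w + ?w \<bullet> hopf_map c"
  have sc: "s \<bullet> c > 0" using p by (simp add: chart_dom_def vs)
  have m: "chart_height c w0 ?q = m"
    unfolding chart_height_def chart_base_chart[OF assms] by (simp add: m_def vs)
  have m0: "m > 0" using chart_in_ran[OF assms, of w0] m by (simp add: chart_ran_def)
  have eta: "chart_spinor c (snd ?q) = inverse (s \<bullet> c) *\<^sub>R ?h"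
    unfolding chart_spinor_def hopf_polar_chart[OF assms] by (simp add: chart_def vs)
  have lift: "lift_spinor ?w (inverse (s \<bullet> c) *\<^sub>R ?h) = (inverse (s \<bullet> c) * m) *\<^sub>R s"
    by (simp add: lift_spinor_scaleR lift_half_spinor(1)[OF e(2) refl] m_def)
  have "norm ?h = sqrt (m / 2)"
    using lift_half_spinor(2)[OF e(2) refl, of s] by (metis m_def norm_ge_zero real_sqrt_unique)
  then have "sqrt (2 * m) * norm ?h = m"
    using m0 by (simp add: real_sqrt_mult[symmetric])
  then have nn: "sqrt (2 * m) * norm (inverse (s \<bullet> c) *\<^sub>R ?h) = m * inverse (s \<bullet> c)"
    using sc by (simp add: mult.assoc[symmetric] mult.commute[of _ "inverse _"])
  have "inverse (m * inverse (s \<bullet> c)) * (inverse (s \<bullet> c) * m) = 1"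
    using sc m0 by (simp add: field_simps)
  then show ?thesis
    unfolding chart_inv_def m eta chart_base_chart[OF assms] nn
    by (simp only: vs snd_conv lift scaleR_scaleR) (simp add: chart_def)
qed

lemma chart_chart_inv:
  assumes c: "norm c = 1" and q: "q \<in> chart_ran c w0"
  shows "chart_inv c w0 q \<in> chart_dom c" "chart c w0 (chart_inv c w0 q) = q"
proof -
  note e = clifford_hopf_map_unit[OF c] and eta = chart_spinor[OF c]
  obtain v z where vz: "q = (v, z)" by fastforce
  let ?w = "chart_base c w0 q" and ?m = "chart_height c w0 q" and ?\<eta> = "chart_spinor c z"
  define l where "l = inverse (sqrt (2 * ?m) * norm ?\<eta>)"
  define s where "s = l *\<^sub>R lift_spinor ?w ?\<eta>"
  have inv: "chart_inv c w0 q = (v, s)" by (simp add: chart_inv_def s_def l_def vz)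
  have m: "?m > 0" using q by (simp add: chart_ran_def)
  have "?\<eta> \<noteq> 0" using eta(2)[of z] by auto
  then have l: "l > 0" "l\<^sup>2 * (2 * ?m * (norm ?\<eta>)\<^sup>2) = 1"
    using m by (auto simp: l_def power_mult_distrib power_inverse field_simps)
  have hs: "hopf_map s = ?w"
    using lift_spinor(1)[OF e(2) eta(1)[of z], of ?w] m l(2)
    by (simp add: s_def hopf_map_scaleR chart_height_def)
  have hf: "half_spinor (hopf_map c) s = (l * ?m) *\<^sub>R ?\<eta>"
  proof -
    have "half_spinor (hopf_map c) s = l *\<^sub>R half_spinor (hopf_map c) (lift_spinor ?w ?\<eta>)"
      by (simp add: s_def half_spinor_def clifford_scaleR_right scaleR_add_right)
    then show ?thesis
      using lift_spinor(2)[OF e(2) eta(1)[of z], of ?w] m by (simp add: chart_height_def)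
  qed
  have sc: "s \<bullet> c = l * ?m"
    using inner_half_spinor[OF e(1), of s] hf eta(2)[of z] by simp
  then show "chart_inv c w0 q \<in> chart_dom c"
    using l m by (simp add: inv chart_dom_def)
  have lam: "inverse (s \<bullet> c) *\<^sub>R half_spinor (hopf_map c) s = ?\<eta>"
  proof -
    have "l * ?m \<noteq> 0" using l(1) m by simp
    then show ?thesis by (simp only: hf sc scaleR_scaleR left_inverse scaleR_one not_False_eq_True)
  qed
  have "leaf_map (v, s) - w0 = hopf_polar c z"
    by (simp add: leaf_map_def hs chart_base_def vz)
  then show "chart c w0 (chart_inv c w0 q) = q"
    using lam by (simp add: inv[unfolded vz] chart_def vz) (simp add: chart_spinor_def)
qed

lemma open_chart_dom: "open (chart_dom c)"
  unfolding chart_dom_def by (intro open_Collect_less continuous_intros)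

lemma Ck_on_A [Ck_intros]: "open S \<Longrightarrow> Ck_on n S f \<Longrightarrow> Ck_on n S (\<lambda>x. A (f x))"
  by (rule Ck_on_compose[of S UNIV f n A]) (auto intro: smooth)

lemma Ck_on_leaf_map [Ck_intros]: "open S \<Longrightarrow> Ck_on n S f \<Longrightarrow> Ck_on n S (\<lambda>x. leaf_map (f x))"
  unfolding leaf_map_def by (intro Ck_intros)

lemma Ck_on_chart: "Ck_on n (chart_dom c) (chart c w0)"
proof -
  have "Ck_on n (chart_dom c) (\<lambda>p. (fst p, clifford (leaf_map p - w0) c +
           inverse (snd p \<bullet> c) *\<^sub>R half_spinor (hopf_map c) (snd p) - c))"
    unfolding half_spinor_def
    by (intro Ck_intros open_chart_dom) (simp add: chart_dom_def)
  then show ?thesis by (simp add: chart_def[abs_def])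
qed

lemma Ck_on_chart_base [Ck_intros]: "open S \<Longrightarrow> Ck_on n S f \<Longrightarrow> Ck_on n S (\<lambda>q. chart_base c w0 (f q))"
  unfolding chart_base_def by (intro Ck_intros)

lemma open_chart_ran: "open (chart_ran c w0)"
proof -
  have "continuous_on UNIV (\<lambda>q. chart_base c w0 q)"
    by (intro Ck_on_continuous_on[of 0] Ck_intros open_UNIV)
  then show ?thesis
    unfolding chart_ran_def chart_height_def by (intro open_Collect_less continuous_intros)
qed

lemma Ck_on_chart_inv:
  assumes c: "norm c = 1"
  shows "Ck_on n (chart_ran c w0) (chart_inv c w0)"
proof -
  have b: "chart_base c w0 q \<noteq> 0" if "q \<in> chart_ran c w0" for q
    using that by (auto simp: chart_ran_def chart_height_def)
  have s: "chart_spinor c z \<noteq> 0" for z using chart_spinor(2)[OF c, of z] by auto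
  have h: "Ck_on n (chart_ran c w0) (\<lambda>q. chart_height c w0 q)"
    unfolding chart_height_def by (intro Ck_intros open_chart_ran b)
  have s': "Ck_on n (chart_ran c w0) (\<lambda>q. chart_spinor c (snd q))"
    unfolding chart_spinor_def by (intro Ck_intros open_chart_ran)
  have "Ck_on n (chart_ran c w0) (\<lambda>q. (fst q,
    inverse (sqrt (2 * chart_height c w0 q) * norm (chart_spinor c (snd q))) *\<^sub>R
      lift_spinor (chart_base c w0 q) (chart_spinor c (snd q))))"
    unfolding lift_spinor_def
    by (intro Ck_intros open_chart_ran h s' b) (use s in \<open>auto simp: chart_ran_def\<close>)
  then show ?thesis by (simp add: chart_inv_def[abs_def])
qed

lemma homeomorphism_chart:
  assumes c: "norm c = 1"
  shows "homeomorphism (chart_dom c) (chart_ran c w0) (chart c w0) (chart_inv c w0)"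
  by (rule homeomorphismI)
    (use chart_in_ran[OF c] chart_chart_inv[OF c] chart_inv_chart[OF c]
      Ck_on_continuous_on[OF Ck_on_chart[of 0]] Ck_on_continuous_on[OF Ck_on_chart_inv[OF c, of 0]]
     in auto)

lemma leaf_in_chart:
  assumes c: "norm c = 1"
  shows "chart c w0 ` (chart_dom c \<inter> leaf_map -` {w0}) = chart_ran c w0 \<inter> {q. hopf_polar c (snd q) = 0}"
proof (intro equalityI subsetI)
  fix q assume "q \<in> chart c w0 ` (chart_dom c \<inter> leaf_map -` {w0})"
  then obtain p where p: "q = chart c w0 p" "p \<in> chart_dom c" "leaf_map p = w0" by blast
  then show "q \<in> chart_ran c w0 \<inter> {q. hopf_polar c (snd q) = 0}"
    using chart_in_ran[OF c] hopf_polar_chart[OF c] by simp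
next
  fix q assume "q \<in> chart_ran c w0 \<inter> {q. hopf_polar c (snd q) = 0}"
  then have q: "q \<in> chart_ran c w0" "hopf_polar c (snd q) = 0" by blast+
  have "leaf_map (chart_inv c w0 q) = w0"
    using hopf_polar_chart[OF c chart_chart_inv(1)[OF c q(1)], of w0] q chart_chart_inv(2)[OF c q(1)] by simp
  then show "q \<in> chart c w0 ` (chart_dom c \<inter> leaf_map -` {w0})"
    using chart_chart_inv[OF c q(1)] by (metis IntI image_eqI vimage_singleton_eq)
qed

text \<open>The kernel is the product of the whole base with the orthogonal complement of the nine-dimensional space of all
  \<open>u c\<close>.\<close>
lemma dim_polar_kernel:
  assumes c: "norm c = 1"
  shows "subspace {q :: 'b \<times> (octonion \<times> octonion). hopf_polar c (snd q) = 0}"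
    "dim {q :: 'b \<times> (octonion \<times> octonion). hopf_polar c (snd q) = 0} = DIM('b) + 7"
proof -
  let ?E = "{q :: 'b \<times> (octonion \<times> octonion). hopf_polar c (snd q) = 0}"
  let ?K = "{z. hopf_polar c z = 0}"
  have E: "?E = UNIV \<times> ?K" by auto
  have sK: "subspace ?K"
    using bounded_linear.linear[OF bounded_linear_hopf_polar] by (rule linear_subspace_kernel)
  then show "subspace ?E" unfolding E by (intro subspace_Times subspace_UNIV)
  have lin: "linear (\<lambda>v. clifford v c)"
    using bilinear_clifford unfolding bilinear_def by blast
  have inj: "inj (\<lambda>v. clifford v c)"
    by (rule inj_on_inverseI[where g="hopf_polar c"]) (rule hopf_polar_clifford[OF c])
  have "dim (range (\<lambda>v. clifford v c)) = 9"
    using dim_image_eq[OF lin, of UNIV] inj by (simp add: dim_UNIV)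
  moreover have "?K = {z \<in> UNIV. \<forall>x\<in>range (\<lambda>v. clifford v c). orthogonal x z}"
  proof -
    have "hopf_polar c z = 0 \<longleftrightarrow> (\<forall>v. hopf_polar c z \<bullet> v = 0)" for z
      by (metis inner_eq_zero_iff inner_zero_left)
    then show ?thesis by (auto simp: orthogonal_def inner_hopf_polar clifford_symmetric)
  qed
  ultimately have "dim ?K + 9 = 16"
    using dim_subspace_orthogonal_to_vectors[OF linear_subspace_image[OF lin subspace_UNIV] subspace_UNIV subset_UNIV]
    by (simp add: dim_UNIV)
  then show "dim ?E = DIM('b) + 7"
    unfolding E by (subst dim_Times) (simp_all add: sK)
qed

text \<open>Over \<open>w = 0\<close> the leaf is the linear subspace \<open>s = 0\<close>. On every other leaf the spinor never vanishes, so each point lies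
  in the chart centred at its own normalised spinor.\<close>
lemma embedded_leaf: "\<exists>d. embedded_submanifold d (leaf_map -` {w})"
proof (cases "w = 0")
  case True
  have n0: "norm (snd p) = 0 \<longleftrightarrow> leaf_map p = 0" for p
    using norm_leaf_map[of p] by (metis norm_eq_zero power_eq_0_iff zero_power2)
  have L: "leaf_map -` {w} = UNIV \<times> {0}"
    by (rule Set.set_eqI) (simp add: mem_Times_iff True n0[symmetric])
  have "embedded_submanifold (dim (UNIV \<times> {0} :: ('b \<times> (octonion \<times> octonion)) set)) (leaf_map -` {w})"
    unfolding embedded_submanifold_def L
  proof (intro ballI exI conjI)
    show "homeomorphism UNIV UNIV (\<lambda>x. x) (\<lambda>x. x)" by (rule homeomorphismI) auto
    show "smooth_on UNIV (\<lambda>x :: 'b \<times> (octonion \<times> octonion). x)"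
      by (simp add: smooth_on_open_iff Ck_on_ident)
    then show "smooth_on UNIV (\<lambda>x :: 'b \<times> (octonion \<times> octonion). x)" .
  qed (auto intro: subspace_Times subspace_UNIV)
  then show ?thesis by blast
next
  case False
  have "embedded_submanifold (DIM('b) + 7) (leaf_map -` {w})"
    unfolding embedded_submanifold_def
  proof
    fix p assume "p \<in> leaf_map -` {w}"
    with False have "snd p \<noteq> 0" by (auto simp: leaf_map_def)
    define c where "c = snd p /\<^sub>R norm (snd p)"
    have c: "norm c = 1" using \<open>snd p \<noteq> 0\<close> by (simp add: c_def)
    have p: "p \<in> chart_dom c"
      using \<open>snd p \<noteq> 0\<close> by (simp add: chart_dom_def c_def)
    show "\<exists>U V E \<phi> \<psi>. open U \<and> p \<in> U \<and> open V \<and> subspace (E :: ('b \<times> (octonion \<times> octonion)) set) \<and> dim E = DIM('b) + 7 \<and>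
       homeomorphism U V \<phi> \<psi> \<and> smooth_on U \<phi> \<and> smooth_on V \<psi> \<and> \<phi> ` (U \<inter> leaf_map -` {w}) = V \<inter> E"
      by (intro exI[of _ "chart_dom c"] exI[of _ "chart_ran c w"] exI[of _ "{q. hopf_polar c (snd q) = 0}"]
          exI[of _ "chart c w"] exI[of _ "chart_inv c w"] conjI open_chart_dom open_chart_ran p
          dim_polar_kernel[OF c] homeomorphism_chart[OF c] leaf_in_chart[OF c])
        (simp_all add: smooth_on_open_iff open_chart_dom open_chart_ran Ck_on_chart Ck_on_chart_inv[OF c])
  qed
  then show ?thesis by blast
qed

end

section \<open>Connectedness of the Hopf fibres and distances between them\<close>

text \<open>A nonzero fibre is the image of a round sphere of dimension 7 under a spin transformation and a
  scaling.\<close>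
lemma connected_hopf_map_fibre: "connected (hopf_map -` {w})"
proof (cases "w = 0")
  case True
  then have "hopf_map -` {w} = {0}" by (intro Set.set_eqI) simp
  then show ?thesis by simp
next
  case False
  obtain A where A: "rotation_matrix A" "A *v axis 1 1 = w /\<^sub>R norm w"
    using rotation_to_unit[of "w /\<^sub>R norm w"] False by auto
  obtain g where g: "spin_lift_of g A" using rotation_has_spin_lift[OF A(1)] by blast
  have "connected (sphere (0::octonion) 1)" by (rule connected_sphere) simp
  then have "connected ((\<lambda>x. (x, 0 :: octonion)) ` sphere (0::octonion) 1)"
    by (rule connected_continuous_image[rotated]) (intro continuous_intros)
  also have "(\<lambda>x. (x, 0 :: octonion)) ` sphere (0::octonion) 1 = hopf_map -` {axis 1 1}"
    unfolding hopf_map_fibre_base by auto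
  finally have "connected (g ` (hopf_map -` {axis 1 1}))"
    by (rule connected_linear_image[OF spin_lift_linear(1)[OF g]])
  also have "g ` (hopf_map -` {axis 1 1}) = hopf_map -` {w /\<^sub>R norm w}"
    using spin_lift_image_fibre[OF g] A unfolding rotation_matrix_def by metis
  finally have "connected ((\<lambda>x. sqrt (norm w) *\<^sub>R x) ` (hopf_map -` {w /\<^sub>R norm w}))"
    by (rule connected_continuous_image[rotated]) (intro continuous_intros)
  then show ?thesis using False by (simp add: scale_fibre)
qed

text \<open>All fibres have constant norm, so minimising the distance from \<open>s\<close> means maximising \<open>\<langle>s, s\<^sub>0\<rangle>\<close> over the
  spinors \<open>s\<^sub>0\<close> above a given \<open>w\<close>. If \<open>s \<noteq> 0\<close>, then \<open>s\<close> lies in the \<open>+1\<close> eigenspace of \<open>e = h s / \<bar>h s\<bar>\<close> and only the projection of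
  \<open>s\<^sub>0\<close> to it counts, whose norm is \<open>\<surd>((\<bar>w\<bar> + \<langle>w, e\<rangle>) / 2)\<close>. This bounds the maximum, and the lift of \<open>s\<close> over
  \<open>w\<close> attains the bound.\<close>
lemma hopf_fibre_transport:
  assumes eq: "hopf_map s1 = hopf_map s2"
  shows "\<exists>s''. hopf_map s'' = hopf_map s' \<and> dist s2 s'' \<le> dist s1 s'"
proof (cases "s1 = 0")
  case True
  then have "s2 = 0" using eq by (metis hopf_map_eq_0_iff)
  with True show ?thesis by blast
next
  case False
  define e where "e = hopf_map s1 /\<^sub>R norm (hopf_map s1)"
  have e: "norm e = 1" using False by (simp add: e_def)
  have n12: "norm s2 = norm s1"
    using eq norm_hopf_map[of s1] norm_hopf_map[of s2] by (metis norm_ge_zero power2_eq_imp_eq)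
  have es: "clifford e s = s" if "hopf_map s = hopf_map s1" for s
    using hopf_map_eq_iff[of s "hopf_map s1"] that False by (simp add: e_def clifford_scaleR_left)
  define w where "w = hopf_map s'"
  define m where "m = norm w + w \<bullet> e"
  have hn: "(norm (half_spinor e s'))\<^sup>2 = m / 2"
    unfolding m_def by (rule lift_half_spinor(2)[OF e w_def[symmetric]])
  then have m0: "m \<ge> 0" by (metis divide_nonneg_pos linorder_not_less order_less_le zero_le_power2 divide_less_0_iff zero_less_numeral)
  have d: "(dist s t)\<^sup>2 = (norm s)\<^sup>2 + (norm t)\<^sup>2 - 2 * (half_spinor e t \<bullet> s)" if "clifford e s = s" for s t
    unfolding inner_half_spinor[OF that] dist_norm power2_norm_eq_inner
    by (simp add: inner_diff_left inner_diff_right inner_commute)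
  have "half_spinor e s' \<bullet> s1 \<le> norm (half_spinor e s') * norm s1"
    by (rule norm_cauchy_schwarz)
  also have "norm (half_spinor e s') = sqrt (m / 2)"
    using hn by (metis norm_ge_zero real_sqrt_unique)
  finally have le: "half_spinor e s' \<bullet> s1 \<le> sqrt (m / 2) * norm s1" .
  show ?thesis
  \<comment> \<open>For \<open>m = 0\<close> all spinors over \<open>w\<close> are orthogonal to the eigenspace of \<open>e\<close> and \<open>s'\<close> itself will do.\<close>
  proof (cases "m = 0")
    case True
    then have "half_spinor e s' = 0" using hn by simp
    then have "(dist s2 s')\<^sup>2 = (dist s1 s')\<^sup>2"
      by (simp add: d es eq n12)
    then show ?thesis by (intro exI[of _ s']) simp
  next
    case False
    with m0 have m: "m > 0" by simp
    have s2: "norm s2 > 0" using \<open>s1 \<noteq> 0\<close> n12 by simp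
    define l where "l = inverse (sqrt (2 * m) * norm s2)"
    define s'' where "s'' = l *\<^sub>R lift_spinor w s2"
    note ls = lift_spinor[OF e es[OF eq[symmetric]] m[unfolded m_def], folded m_def]
    have l2: "l\<^sup>2 * (2 * m * (norm s2)\<^sup>2) = 1"
      using m s2 by (auto simp: l_def power_mult_distrib power_inverse field_simps)
    have h: "hopf_map s'' = w"
      using l2 by (simp add: s''_def hopf_map_scaleR ls)
    then have n: "norm s'' = norm s'"
      using norm_hopf_map[of s'] norm_hopf_map[of s''] by (metis w_def norm_ge_zero power2_eq_imp_eq)
    have "half_spinor e s'' = l *\<^sub>R half_spinor e (lift_spinor w s2)"
      by (simp add: s''_def half_spinor_def clifford_scaleR_right scaleR_add_right)
    then have hs: "half_spinor e s'' = (l * m) *\<^sub>R s2" by (simp add: ls)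
    have "sqrt (m / 2) * sqrt (2 * m) = m"
      using m by (simp add: real_sqrt_mult[symmetric])
    then have "sqrt (m / 2) = m / sqrt (2 * m)" using m by (simp add: field_simps)
    then have "l * m * (norm s2)\<^sup>2 = sqrt (m / 2) * norm s2"
      using m s2 by (simp add: l_def power2_eq_square field_simps)
    then have "half_spinor e s'' \<bullet> s2 = sqrt (m / 2) * norm s1"
      by (simp add: hs power2_norm_eq_inner[symmetric] n12)
    then have "(dist s2 s'')\<^sup>2 \<le> (dist s1 s')\<^sup>2"
      using le by (simp add: d es eq n12 n)
    then have "dist s2 s'' \<le> dist s1 s'" by (rule power2_le_imp_le) simp
    with h w_def show ?thesis by blast
  qed
qed

section \<open>Infinitesimal spin transformations\<close>

text \<open>For skew \<open>B\<close> this is the element of the spin Lie algebra whose commutator with the Clifford multiplication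
  by \<open>v\<close> is that by \<open>B v\<close>.\<close>
definition spin_generator :: "real ^ 9 ^ 9 \<Rightarrow> octonion \<times> octonion \<Rightarrow> octonion \<times> octonion"
  where "spin_generator B s =
    (1/4) *\<^sub>R (\<Sum>i\<in>UNIV. \<Sum>j\<in>UNIV. (B $ i $ j) *\<^sub>R clifford (axis i 1) (clifford (axis j 1) s))"

text \<open>The left-hand side is the derivative of the Hopf map along the generator: the infinitesimal form of
  \<open>h(g s) = A h(s)\<close>. Moving \<open>v\<close> through two Clifford multiplications by means of the anticommutation relations
  reverses their order, up to terms linear in \<open>h s\<close>; skewness of \<open>B\<close> turns the reversal into a change of sign.\<close>
lemma hopf_polar_spin_generator:
  assumes skew: "\<And>i j. B $ j $ i = - B $ i $ j"
  shows "2 *\<^sub>R hopf_polar s (spin_generator B s) = B *v hopf_map s"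
proof (rule vector_eq_rdot[THEN iffD1], intro allI)
  fix v
  define f where "f i j = s \<bullet> clifford v (clifford (axis i 1) (clifford (axis j 1) s))" for i j
  define S where "S = (\<Sum>i\<in>UNIV. \<Sum>j\<in>UNIV. B $ i $ j * f i j)"
  define T where "T = (\<Sum>i\<in>UNIV. \<Sum>j\<in>UNIV. B $ i $ j * (v $ i * hopf_map s $ j))"
  have lin: "linear (clifford u)" for u
    using bilinear_clifford unfolding bilinear_def by blast
  have 1: "hopf_polar s (spin_generator B s) \<bullet> v = S / 4"
    by (simp add: inner_hopf_polar spin_generator_def S_def f_def linear_sum[OF lin] linear_scale[OF lin]
        inner_sum_right)
  have ff: "f i j = 2 * (v $ i * hopf_map s $ j) - 2 * (v $ j * hopf_map s $ i) + f j i" for i j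
  proof -
    let ?a = "clifford (axis i 1)" and ?b = "clifford (axis j 1)" and ?v = "clifford v"
    have "f i j = s \<bullet> ?b (?a (?v s))"
      unfolding f_def by (metis clifford_symmetric inner_commute)
    also have "?a (?v s) = (2 * v $ i) *\<^sub>R s - ?v (?a s)"
      using clifford_anticommute[of "axis i 1" v s] by (simp add: inner_axis' algebra_simps)
    also have "?b ((2 * v $ i) *\<^sub>R s - ?v (?a s)) = (2 * v $ i) *\<^sub>R ?b s - ?b (?v (?a s))"
      by (simp add: clifford_diff_right clifford_scaleR_right)
    also have "?b (?v (?a s)) = (2 * v $ j) *\<^sub>R ?a s - ?v (?b (?a s))"
      using clifford_anticommute[of "axis j 1" v "?a s"] by (simp add: inner_axis' algebra_simps)
    finally show ?thesis
      by (simp add: f_def inner_diff_right hopf_map_def)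
  qed
  have sw: "(\<Sum>i\<in>UNIV. \<Sum>j\<in>UNIV. B $ i $ j * g j i) = - (\<Sum>i\<in>UNIV. \<Sum>j\<in>UNIV. B $ i $ j * g i j)" for g :: "9 \<Rightarrow> 9 \<Rightarrow> real"
  proof -
    have "(\<Sum>i\<in>UNIV. \<Sum>j\<in>UNIV. B $ i $ j * g j i) = (\<Sum>j\<in>UNIV. \<Sum>i\<in>UNIV. B $ i $ j * g j i)"
      by (rule sum.swap)
    also have "\<dots> = (\<Sum>j\<in>UNIV. \<Sum>i\<in>UNIV. - (B $ j $ i * g j i))"
      by (intro sum.cong refl) (metis skew mult_minus_left)
    finally show ?thesis by (simp add: sum_negf)
  qed
  have "S = (\<Sum>i\<in>UNIV. \<Sum>j\<in>UNIV. 2 * (B $ i $ j * (v $ i * hopf_map s $ j))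
      - 2 * (B $ i $ j * (v $ j * hopf_map s $ i)) + B $ i $ j * f j i)"
    unfolding S_def by (subst ff) (simp add: algebra_simps)
  also have "\<dots> = 2 * T - 2 * (\<Sum>i\<in>UNIV. \<Sum>j\<in>UNIV. B $ i $ j * (v $ j * hopf_map s $ i))
      + (\<Sum>i\<in>UNIV. \<Sum>j\<in>UNIV. B $ i $ j * f j i)"
    by (simp add: T_def sum.distrib sum_subtractf sum_distrib_left)
  also have "\<dots> = 4 * T - S"
    using sw[of f] sw[of "\<lambda>i j. v $ i * hopf_map s $ j"] by (simp add: T_def S_def)
  finally have "S = 2 * T" by simp
  moreover have "(B *v hopf_map s) \<bullet> v = T"
    by (simp add: inner_vec_def matrix_vector_mult_def T_def sum_distrib_left sum_distrib_right mult_ac)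
  ultimately show "(2 *\<^sub>R hopf_polar s (spin_generator B s)) \<bullet> v = (B *v hopf_map s) \<bullet> v"
    using 1 by simp
qed

lemma bounded_linear_spin_generator: "bounded_linear (spin_generator B)"
proof -
  have "bounded_linear (clifford v)" for v
    by (rule bounded_bilinear.bounded_linear_right[OF bounded_bilinear_clifford])
  then show ?thesis
    unfolding spin_generator_def
    by (intro bounded_linear_scaleR_right[THEN bounded_linear_compose] bounded_linear_sum
        bounded_linear_compose[of "clifford _" "clifford _"])
qed

section \<open>Tangent vectors of the leaves\<close>

lemma tangent_vector_derivative_zero:
  assumes "v \<in> tangent_vectors (f -` {a}) q" "(f has_derivative D) (at q)"
  shows "D v = 0"
proof -
  obtain \<epsilon> c where c: "\<epsilon> > 0" "c 0 = q" "c ` {-\<epsilon><..<\<epsilon>} \<subseteq> f -` {a}"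
    "(c has_vector_derivative v) (at (0::real))"
    using assms(1) unfolding tangent_vectors_def by blast
  have "((\<lambda>t. f (c t)) has_derivative (\<lambda>t. D (t *\<^sub>R v))) (at 0)"
    using diff_chain_at[OF c(4)[unfolded has_vector_derivative_def], of f D] assms(2) c(2)
    by (simp add: o_def)
  then have "((\<lambda>t. a) has_derivative (\<lambda>t. D (t *\<^sub>R v))) (at 0)"
  proof (rule has_derivative_transform_within_open)
    show "f (c t) = a" if "t \<in> {-\<epsilon><..<\<epsilon>}" for t using c(3) that by blast
  qed (use c(1) in auto)
  then have "(\<lambda>t. D (t *\<^sub>R v)) = (\<lambda>t. 0)"
    by (rule has_derivative_unique) (rule has_derivative_const)
  then have "D (1 *\<^sub>R v) = 0" by meson
  then show ?thesis by simp
qed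

context twisted_hopf
begin

text \<open>Differentiation of \<open>hopf_polar_chart\<close>, of its inverse form, and of \<open>chart_inv_chart\<close>.\<close>
lemma chart_derivatives:
  assumes c: "norm c = 1"
  shows "p \<in> chart_dom c \<Longrightarrow> (leaf_map has_derivative D) (at p) \<Longrightarrow>
      hopf_polar c (snd (frechet_derivative (chart c w0) (at p) v)) = D v"
    "y \<in> chart_ran c w0 \<Longrightarrow> (leaf_map has_derivative D) (at (chart_inv c w0 y)) \<Longrightarrow>
      D (frechet_derivative (chart_inv c w0) (at y) x) = hopf_polar c (snd x)"
    "p \<in> chart_dom c \<Longrightarrow>
      frechet_derivative (chart_inv c w0) (at (chart c w0 p)) (frechet_derivative (chart c w0) (at p) v) = v"
proof -
  note d1 = Ck_on_SucD(1)[OF Ck_on_chart[of "Suc 0" c w0]]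
  note d2 = Ck_on_SucD(1)[OF Ck_on_chart_inv[OF c, of "Suc 0" w0]]
  have lin: "bounded_linear (\<lambda>x. hopf_polar c (snd x :: octonion \<times> octonion))"
    by (rule bounded_linear_compose[OF bounded_linear_hopf_polar bounded_linear_snd])
  {
    assume p: "p \<in> chart_dom c" and D: "(leaf_map has_derivative D) (at p)"
    have "((\<lambda>p. hopf_polar c (snd (chart c w0 p))) has_derivative
        (\<lambda>v. hopf_polar c (snd (frechet_derivative (chart c w0) (at p) v)))) (at p)"
      by (rule bounded_linear.has_derivative[OF lin d1[OF p]])
    moreover have "((\<lambda>p. hopf_polar c (snd (chart c w0 p))) has_derivative D) (at p)"
      by (rule has_derivative_transform_within_open[of "\<lambda>p. leaf_map p - w0" _ _ _ "chart_dom c"])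
        (use p D hopf_polar_chart[OF c] in \<open>auto intro!: open_chart_dom derivative_eq_intros\<close>)
    ultimately show "hopf_polar c (snd (frechet_derivative (chart c w0) (at p) v)) = D v"
      using has_derivative_unique by metis
  }
  {
    assume y: "y \<in> chart_ran c w0" and D: "(leaf_map has_derivative D) (at (chart_inv c w0 y))"
    have "((\<lambda>y. leaf_map (chart_inv c w0 y)) has_derivative
        (\<lambda>x. D (frechet_derivative (chart_inv c w0) (at y) x))) (at y)"
      using diff_chain_at[OF d2[OF y] D] by (simp add: o_def)
    then have "((\<lambda>y. hopf_polar c (snd y) + w0) has_derivative
        (\<lambda>x. D (frechet_derivative (chart_inv c w0) (at y) x))) (at y)"
    proof (rule has_derivative_transform_within_open[OF _ open_chart_ran y])
      fix z assume "z \<in> chart_ran c w0"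
      then show "leaf_map (chart_inv c w0 z) = hopf_polar c (snd z) + w0"
        using chart_chart_inv[OF c] hopf_polar_chart[OF c] by (metis diff_add_cancel)
    qed
    moreover have "((\<lambda>y. hopf_polar c (snd y) + w0) has_derivative (\<lambda>x. hopf_polar c (snd x))) (at y)"
      using bounded_linear_imp_has_derivative[OF lin] by (auto intro!: derivative_eq_intros)
    ultimately show "D (frechet_derivative (chart_inv c w0) (at y) x) = hopf_polar c (snd x)"
      using has_derivative_unique by metis
  }
  {
    assume p: "p \<in> chart_dom c"
    have "((\<lambda>p. chart_inv c w0 (chart c w0 p)) has_derivative
       (\<lambda>v. frechet_derivative (chart_inv c w0) (at (chart c w0 p)) (frechet_derivative (chart c w0) (at p) v))) (at p)"
      using diff_chain_at[OF d1[OF p] d2[OF chart_in_ran[OF c p]]] by (simp add: o_def)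
    moreover have "((\<lambda>p. chart_inv c w0 (chart c w0 p)) has_derivative (\<lambda>v. v)) (at p)"
      by (rule has_derivative_transform_within_open[of "\<lambda>p. p" _ _ _ "chart_dom c"])
        (use p chart_inv_chart[OF c] in \<open>auto intro!: open_chart_dom\<close>)
    ultimately show "frechet_derivative (chart_inv c w0) (at (chart c w0 p)) (frechet_derivative (chart c w0) (at p) v) = v"
      using has_derivative_unique by metis
  }
qed

lemma leaf_map_has_derivative: "(leaf_map has_derivative frechet_derivative leaf_map (at q)) (at q)"
  using Ck_on_SucD(1)[of 0 UNIV leaf_map q] Ck_on_leaf_map[OF open_UNIV Ck_on_ident[OF open_UNIV]] by blast

lemma unit_chart:
  assumes "snd q \<noteq> 0"
  obtains c where "norm c = 1" "q \<in> chart_dom c"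
  using assms by (intro that[of "snd q /\<^sub>R norm (snd q)"]) (auto simp: chart_dom_def)

text \<open>The required curve in the leaf is the preimage of a straight line in a chart: the line stays in the straightened leaf because its
  direction is killed by the linear map that represents \<^term>\<open>leaf_map\<close>.\<close>
lemma kernel_imp_tangent:
  assumes q: "snd q \<noteq> 0" and D: "(leaf_map has_derivative D) (at q)" "D x = 0"
  shows "x \<in> tangent_vectors (leaf_map -` {leaf_map q}) q"
proof -
  obtain c where c: "norm c = 1" "q \<in> chart_dom c" using unit_chart[OF q] .
  let ?w = "leaf_map q"
  let ?\<phi> = "chart c ?w" and ?\<psi> = "chart_inv c ?w"
  define e where "e = frechet_derivative ?\<phi> (at q) x"
  define l where "l t = ?\<phi> q + t *\<^sub>R e" for t :: real
  define \<gamma> where "\<gamma> t = ?\<psi> (l t)" for t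
  have pe: "hopf_polar c (snd e) = 0"
    unfolding e_def using chart_derivatives(1)[OF c D(1)] D(2) by simp
  have "open (l -` chart_ran c ?w)"
    by (rule continuous_open_vimage[OF open_chart_ran]) (simp add: l_def[abs_def])
  moreover have "0 \<in> l -` chart_ran c ?w"
    by (simp add: l_def chart_in_ran[OF c])
  ultimately obtain \<epsilon> where \<epsilon>: "\<epsilon> > 0" "ball 0 \<epsilon> \<subseteq> l -` chart_ran c ?w"
    using open_contains_ball by blast
  have ran: "l t \<in> chart_ran c ?w" if "t \<in> {-\<epsilon><..<\<epsilon>}" for t
    using \<epsilon>(2) that by (auto simp: subset_eq)
  have pl: "hopf_polar c (snd (l t)) = 0" for t
    using pe by (simp add: l_def hopf_polar_add_right hopf_polar_scaleR_right hopf_polar_chart[OF c])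
  have leaf: "\<gamma> t \<in> leaf_map -` {?w}" if "t \<in> {-\<epsilon><..<\<epsilon>}" for t
    using hopf_polar_chart[OF c(1) chart_chart_inv(1)[OF c(1) ran[OF that]], of ?w]
      chart_chart_inv(2)[OF c(1) ran[OF that]] pl[of t] by (simp add: \<gamma>_def)
  have "Ck_on n {-\<epsilon><..<\<epsilon>} \<gamma>" for n
    unfolding \<gamma>_def
    by (rule Ck_on_compose[OF _ open_chart_ran ran _ Ck_on_chart_inv[OF c(1)]])
      (auto simp: l_def intro!: Ck_intros)
  then have smooth: "smooth_on {-\<epsilon><..<\<epsilon>} \<gamma>" by (simp add: smooth_on_open_iff)
  have "(l has_derivative (\<lambda>t. t *\<^sub>R e)) (at 0)"
    unfolding l_def by (auto intro!: derivative_eq_intros)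
  moreover have d2: "(?\<psi> has_derivative frechet_derivative ?\<psi> (at (l 0))) (at (l 0))"
    using Ck_on_SucD(1)[OF Ck_on_chart_inv[OF c(1), of "Suc 0" ?w] chart_in_ran[OF c]] by (simp add: l_def)
  ultimately have "(\<gamma> has_derivative (\<lambda>t. frechet_derivative ?\<psi> (at (l 0)) (t *\<^sub>R e))) (at 0)"
    using diff_chain_at[of l _ 0 ?\<psi>] unfolding \<gamma>_def o_def by blast
  moreover have "frechet_derivative ?\<psi> (at (l 0)) (t *\<^sub>R e) = t *\<^sub>R x" for t
    using linear_scale[OF has_derivative_linear[OF d2]] chart_derivatives(3)[OF c, of ?w x]
    by (simp add: l_def e_def)
  ultimately have "(\<gamma> has_vector_derivative x) (at 0)"
    by (simp add: has_vector_derivative_def)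
  moreover have "\<gamma> 0 = q" by (simp add: \<gamma>_def l_def chart_inv_chart[OF c])
  ultimately show ?thesis
    unfolding tangent_vectors_def using \<epsilon>(1) leaf smooth by blast
qed

text \<open>In a chart the field is constant. Its direction lies in the common tangent space of all the straightened
  leaves, so it is tangent to every leaf, not only to the one through \<open>p\<close>.\<close>
lemma tangent_field_regular:
  assumes p: "snd p \<noteq> 0" and v: "v \<in> tangent_vectors (leaf_map -` {leaf_map p}) p"
  shows "\<exists>U X. open U \<and> p \<in> U \<and> smooth_on U X \<and> X p = v \<and>
    (\<forall>q\<in>U. X q \<in> tangent_vectors (leaf_map -` {leaf_map q}) q)"
proof -
  obtain c where c: "norm c = 1" "p \<in> chart_dom c" using unit_chart[OF p] .
  let ?w = "leaf_map p"
  let ?\<phi> = "chart c ?w" and ?\<psi> = "chart_inv c ?w"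
  define e where "e = frechet_derivative ?\<phi> (at p) v"
  define X where "X q = frechet_derivative ?\<psi> (at (?\<phi> q)) e" for q
  have pe: "hopf_polar c (snd e) = 0"
    unfolding e_def
    using chart_derivatives(1)[OF c leaf_map_has_derivative] tangent_vector_derivative_zero[OF v leaf_map_has_derivative]
    by simp
  have "Ck_on n (chart_dom c) X" for n
    unfolding X_def
    by (rule Ck_on_compose[OF open_chart_dom open_chart_ran chart_in_ran[OF c(1)] Ck_on_chart
          Ck_on_SucD(2)[OF Ck_on_chart_inv[OF c(1)]]])
  then have "smooth_on (chart_dom c) X" by (simp add: smooth_on_open_iff open_chart_dom)
  moreover have "X q \<in> tangent_vectors (leaf_map -` {leaf_map q}) q" if q: "q \<in> chart_dom c" for q
  proof (rule kernel_imp_tangent[OF _ leaf_map_has_derivative])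
    show "snd q \<noteq> 0" using q by (auto simp: chart_dom_def)
    show "frechet_derivative leaf_map (at q) (X q) = 0"
      unfolding X_def
      using chart_derivatives(2)[where ?w0.0="?w" and y="?\<phi> q" and D="frechet_derivative leaf_map (at q)" and x=e,
          OF c(1) chart_in_ran[OF c(1) q]]
        leaf_map_has_derivative[of q] pe
      by (simp add: chart_inv_chart[OF c(1) q])
  qed
  moreover have "X p = v" unfolding X_def e_def by (rule chart_derivatives(3)[OF c])
  ultimately show ?thesis using c(2) open_chart_dom by blast
qed

lemma closed_leaf: "closed (leaf_map -` {w})"
  by (rule continuous_closed_vimage)
    (auto intro: has_derivative_continuous[OF leaf_map_has_derivative])

lemma fst_leaf: "fst ` (leaf_map -` {w}) = UNIV"
proof (intro equalityI subsetI)
  fix v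
  obtain s where "hopf_map s = A v *v w" using surj_hopf_map by blast
  then have "(v, s) \<in> leaf_map -` {w}" by (simp add: leaf_map_eq_iff)
  then show "v \<in> fst ` (leaf_map -` {w})" by force
qed simp

text \<open>The projection to the base has connected fibres, the Hopf fibres, and it is a closed map because the
  spinors in a leaf have constant norm; a closed surjection with connected fibres onto a connected space has a connected
  domain.\<close>
lemma connected_leaf: "connected (leaf_map -` {w})"
proof -
  let ?L = "leaf_map -` {w}"
  have "connected (?L \<inter> fst -` UNIV)"
  proof (rule connected_closed_monotone_preimage)
    show "continuous_on ?L fst" by (intro continuous_intros)
    show "fst ` ?L = UNIV" by (rule fst_leaf)
    show "closedin (top_of_set UNIV) (fst ` C)" if "closedin (top_of_set ?L) C" for C
    proof (rule Starlike.closed_map_fst)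
      have C: "closed C" "C \<subseteq> ?L"
        using that closed_leaf closedin_closed_trans closedin_imp_subset by blast+
      have "(norm (snd p))\<^sup>2 = norm w" if "p \<in> ?L" for p
        using that norm_leaf_map[of p] by simp
      then have "norm (snd p) \<le> sqrt (norm w)" if "p \<in> ?L" for p
        using that by (metis real_le_rsqrt order_refl)
      then have "C \<subseteq> UNIV \<times> cball 0 (sqrt (norm w))"
        using C(2) by (auto simp: mem_Times_iff)
      then show "closedin (top_of_set (UNIV \<times> cball 0 (sqrt (norm w)))) C"
        using C(1) by (rule closed_subset)
    qed simp
    show "connected (?L \<inter> fst -` {v})" for v
    proof -
      have "?L \<inter> fst -` {v} = {v} \<times> (hopf_map -` {A v *v w})"
        by (intro Set.set_eqI) (auto simp: leaf_map_eq_iff mem_Times_iff)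
      then show ?thesis by (simp add: connected_Times connected_hopf_map_fibre)
    qed
  qed auto
  then show ?thesis by simp
qed

end

section \<open>Isometries that preserve the Hopf map\<close>

lemma hopf_polar_commute: "hopf_polar s t = hopf_polar t s"
  unfolding hopf_polar_def by (simp add: clifford_symmetric[symmetric] inner_commute[of _ t])

text \<open>Polarising \<open>h \<circ> L = h\<close> gives \<open>\<langle>L s, v (L t)\<rangle> = \<langle>s, v t\<rangle> = \<langle>L s, L (v t)\<rangle>\<close> for all \<open>s\<close>, and \<open>L\<close> is onto.\<close>
lemma hopf_isometry_commutes_clifford:
  assumes L: "linear L" and h: "\<And>s. hopf_map (L s) = hopf_map s"
  shows "L (clifford v t) = clifford v (L t)"
proof -
  have n: "norm (L s) = norm s" for s
    using norm_hopf_map[of s] norm_hopf_map[of "L s"] h by (metis norm_ge_zero power2_eq_imp_eq)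
  have inn: "L s \<bullet> L t = s \<bullet> t" for s t
  proof -
    have "orthogonal_transformation L" using L n by (simp add: orthogonal_transformation)
    then show ?thesis by (simp add: orthogonal_transformation_def)
  qed
  have hadd: "hopf_map (x + y) = hopf_map x + hopf_map y + 2 *\<^sub>R hopf_polar x y" for x y
    unfolding hopf_map_polar
    by (simp add: hopf_polar_add_left hopf_polar_add_right hopf_polar_commute[of y x] scaleR_2)
  have pol: "hopf_polar (L s) (L t) = hopf_polar s t" for s t
    using hadd[of s t] hadd[of "L s" "L t"] h[of "s + t"] by (simp add: linear_add[OF L] h)
  have "inj L" by (rule linear_injective_0[OF L, THEN iffD2]) (metis n norm_eq_zero)
  then have "surj L" using linear_injective_imp_surjective[OF L] by auto
  then obtain s where s: "L s = clifford v (L t) - L (clifford v t)" by (metis surjD)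
  have "L s \<bullet> clifford v (L t) = s \<bullet> clifford v t"
    using pol[of s t] inner_hopf_polar by metis
  then have "L s \<bullet> (clifford v (L t) - L (clifford v t)) = 0"
    by (simp add: inner_diff_right inn)
  then show ?thesis unfolding s by simp
qed

text \<open>An \<open>L\<close> that commutes with Clifford multiplication and takes \<open>(1, 0)\<close> to \<open>(l, 0)\<close> takes \<open>(p, 0)\<close> to \<open>(p l, 0)\<close> and
  \<open>(p q, 0)\<close> to both \<open>((p q) l, 0)\<close> and \<open>(p (q l), 0)\<close>. For \<open>p = i\<close>, \<open>q = j\<close> and \<open>l\<close> the unit of the second
  Cayley--Dickson summand these differ in sign.\<close>
lemma hopf_isometry_base_neq:
  assumes L: "linear L" and h: "\<And>s. hopf_map (L s) = hopf_map s"
  shows "L hopf_base \<noteq> (((0, 0), (1, 0)), 0)"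
proof
  assume a: "L hopf_base = (((0, 0), (1, 0)), 0)"
  define qi qj qk l :: octonion where "qi = ((\<i>, 0), (0, 0))" and "qj = ((0, 1), (0, 0))"
    and "qk = ((0, \<i>), (0, 0))" and "l = ((0, 0), (1, 0))"
  define T where "T p = clifford (vec9 0 p)" for p
  have com: "L (T p s) = T p (L s)" for p s
    unfolding T_def by (rule hopf_isometry_commutes_clifford[OF L h])
  have T1: "T p (T oct_one (x, 0)) = (oct_mult p x, 0)" for p x
    by (simp add: T_def del: oct_cnj.simps)
  have base: "hopf_base = (oct_one, 0)" by (rule hopf_base_def)
  have ij: "oct_mult qi qj = qk" by (simp add: qi_def qj_def qk_def)
  have "L (T qi (T oct_one (T qj (T oct_one hopf_base)))) = L (T qk (T oct_one hopf_base))"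
    by (simp only: base T1 oct_mult_one ij)
  then have "oct_mult qi (oct_mult qj l) = oct_mult qk l"
    by (simp only: com a l_def[symmetric] T1 prod.inject)
  then show False by (simp add: qi_def qj_def qk_def l_def oct_alt complex_eq_iff)
qed

context twisted_hopf
begin

definition leaves :: "('b \<times> (octonion \<times> octonion)) set set"
  where "leaves = range (\<lambda>w. leaf_map -` {w})"

lemma not_compact_leaf: "\<not> compact (leaf_map -` {w})"
proof
  assume "compact (leaf_map -` {w})"
  then have "compact (fst ` (leaf_map -` {w}))"
    by (rule compact_continuous_image[rotated]) (intro continuous_intros)
  then show False
    unfolding fst_leaf using compact_imp_bounded not_bounded_UNIV by blast
qed

text \<open>The group enters only through a single element, which moves \<open>(0, (1, 0))\<close> within its leaf. It keeps
  distances and preserves the leaf of \<open>0\<close>, which is the base, and \<open>0\<close> is the only point of the base at distance 1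
  from the image of \<open>(0, (1, 0))\<close>; so it fixes \<open>0\<close> and is an orthogonal transformation that preserves the base and
  its orthogonal complement.\<close>
lemma inhomogeneous: "\<not> homogeneous_foliation TYPE('g::euclidean_space) leaves"
proof
  assume "homogeneous_foliation TYPE('g) leaves"
  then obtain G :: "'g monoid" and \<phi> where G: "group_action G UNIV \<phi>"
    and iso: "\<forall>g\<in>carrier G. \<forall>x y. dist (\<phi> g x) (\<phi> g y) = dist x y"
    and orb: "leaves = orbits G UNIV \<phi>"
    unfolding homogeneous_foliation_def by blast
  have leaf_orbit: "leaf_map -` {leaf_map x} = orbit G \<phi> x" for x
  proof -
    have "leaf_map -` {leaf_map x} \<in> orbits G UNIV \<phi>" unfolding orb[symmetric] leaves_def by blast
    then obtain y where y: "leaf_map -` {leaf_map x} = orbit G \<phi> y" unfolding orbits_def by blast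
    then have xy: "x \<in> orbit G \<phi> y" by auto
    then have yx: "y \<in> orbit G \<phi> x" using group_action.orbit_sym[OF G] by blast
    note trans = group_action.orbit_trans[OF G UNIV_I UNIV_I UNIV_I]
    show ?thesis
      unfolding y
    proof (intro equalityI subsetI)
      fix z show "z \<in> orbit G \<phi> x" if "z \<in> orbit G \<phi> y" by (rule trans[OF yx that])
      show "z \<in> orbit G \<phi> y" if "z \<in> orbit G \<phi> x" by (rule trans[OF xy that])
    qed
  qed
  define s1 :: "octonion \<times> octonion" where "s1 = (((0, 0), (1, 0)), 0)"
  have n: "norm hopf_base = 1" "norm s1 = 1" by (simp_all add: hopf_base_def s1_def norm_Pair)
  have "hopf_base \<in> hopf_map -` {axis 1 1}" "s1 \<in> hopf_map -` {axis 1 1}"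
    unfolding hopf_map_fibre_base by (auto simp: hopf_base_def s1_def norm_Pair)
  then have "leaf_map (0, s1) = leaf_map (0, hopf_base)" by (simp add: leaf_map_def)
  then have "(0, s1) \<in> orbit G \<phi> (0, hopf_base)" using leaf_orbit[of "(0, hopf_base)"] by auto
  then have "\<exists>g. g \<in> carrier G \<and> \<phi> g (0, hopf_base) = (0, s1)"
    unfolding orbit_def mem_Collect_eq by metis
  then obtain g where g: "g \<in> carrier G" "\<phi> g (0, hopf_base) = (0, s1)" by metis
  define f where "f = \<phi> g"
  have tf: "leaf_map (f x) = leaf_map x" for x
  proof -
    have "f x \<in> orbit G \<phi> x" unfolding orbit_def f_def using g(1) by blast
    then show ?thesis using leaf_orbit[of x] by auto
  qed
  have t0: "leaf_map x = 0 \<longleftrightarrow> snd x = 0" for x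
    using norm_leaf_map[of x] by (metis norm_eq_zero power_eq_0_iff zero_power2)
  have "snd (f 0) = 0" using tf[of 0] t0 by (metis snd_zero)
  moreover have "dist (f 0) (f (0, hopf_base)) = dist 0 (0 :: 'b, hopf_base)"
    unfolding f_def by (rule iso[rule_format, OF g(1)])
  then have "dist (f 0) (0, s1) = dist 0 (0 :: 'b, hopf_base)"
    by (simp only: f_def g(2))
  ultimately have "(norm (fst (f 0)))\<^sup>2 + 1 = 1"
    using n by (cases "f 0") (simp add: dist_Pair_Pair dist_norm norm_Pair)
  then have f0: "f 0 = 0" using \<open>snd (f 0) = 0\<close> by (simp add: prod_eq_iff)
  have ot: "orthogonal_transformation f"
    unfolding orthogonal_transformation_isometry using f0 iso g(1) by (auto simp: f_def)
  then have lin: "linear f" and inn: "f x \<bullet> f y = x \<bullet> y" for x y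
    by (auto simp: orthogonal_transformation_def)
  define L where "L s = snd (f (0, s))" for s
  have "fst (f (0, s)) = 0" for s
  proof -
    obtain x where x: "f x = (fst (f (0, s)), 0)"
      using orthogonal_transformation_surj[OF ot] by (metis surjD)
    then have "snd x = 0" using tf[of x] t0[of x] t0[of "f x"] by simp
    then have "f (0, s) \<bullet> f x = 0" unfolding inn by (cases x) simp
    then show ?thesis unfolding x by (cases "f (0, s)") simp
  qed
  then have fL: "f (0, s) = (0, L s)" for s by (simp add: L_def prod_eq_iff)
  have "linear L"
    unfolding L_def using lin
    by (intro linearI) (simp_all add: linear_add[symmetric] linear_scale[symmetric] snd_add[symmetric] snd_scaleR[symmetric] del: snd_add snd_scaleR)
  moreover have "hopf_map (L s) = hopf_map s" for s
    using tf[of "(0, s)"] by (metis fL fst_conv snd_conv leaf_map_eq_iff)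
  moreover have "L hopf_base = s1" using g(2) unfolding L_def f_def by simp
  ultimately show False using hopf_isometry_base_neq unfolding s1_def by blast
qed

end

section \<open>Twists by a homomorphism\<close>

locale hopf_twist =
  fixes \<Psi> :: "'b::euclidean_space \<Rightarrow> real ^ 9 ^ 9"
  assumes rot: "rotation_matrix (\<Psi> v)"
    and add: "\<Psi> (v + w) = \<Psi> v ** \<Psi> w"
    and smooth_twist: "Ck_on n UNIV \<Psi>"

sublocale hopf_twist \<subseteq> twisted_hopf \<Psi>
  using rot smooth_twist by unfold_locales (auto simp: rotation_matrix_def)

context hopf_twist
begin

lemma twist_zero: "\<Psi> 0 = mat 1"
proof (rule matrix_eqI)
  fix w
  have "\<Psi> 0 *v w = \<Psi> 0 *v (\<Psi> 0 *v w)"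
    using add[of 0 0] by (simp add: matrix_vector_mul_assoc)
  then show "\<Psi> 0 *v w = mat 1 *v w" by (metis A_transpose(2) matrix_vector_mul_lid)
qed

text \<open>Translate the base by \<open>v\<^sub>2 - v\<^sub>1\<close> and apply a spin lift of its image under \<open>\<Psi>\<close>. This isometry
  preserves all leaves and carries \<open>p\<close> into the layer of \<open>q\<close>, where \<open>hopf_fibre_transport\<close> finishes.\<close>
lemma leaf_transport:
  assumes p: "leaf_map p = leaf_map q"
  shows "\<exists>b. leaf_map b = leaf_map a \<and> dist q b \<le> dist p a"
proof -
  obtain v1 s1 v2 s2 v s where pq: "p = (v1, s1)" "q = (v2, s2)" "a = (v, s)" by (metis surj_pair)
  obtain g where g: "spin_lift_of g (\<Psi> (v2 - v1))" using rotation_has_spin_lift[OF rot] by blast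
  have hg: "hopf_map (g x) = \<Psi> (v2 - v1) *v hopf_map x" for x
    by (rule spin_lift_hopf_map[OF g orth])
  have shift: "\<Psi> (v2 - v1) *v (\<Psi> x *v w) = \<Psi> (x + v2 - v1) *v w" for x w
    by (simp add: matrix_vector_mul_assoc add[symmetric] algebra_simps)
  have "hopf_map s1 = \<Psi> v1 *v leaf_map q" "hopf_map s2 = \<Psi> v2 *v leaf_map q"
    using leaf_map_eq_iff[of p "leaf_map q"] leaf_map_eq_iff[of q "leaf_map q"] p pq by auto
  then have "hopf_map (g s1) = hopf_map s2" by (simp add: hg shift)
  then obtain s'' where s'': "hopf_map s'' = hopf_map (g s)" "dist s2 s'' \<le> dist (g s1) (g s)"
    using hopf_fibre_transport by blast
  have "dist (g s1) (g s) = dist s1 s"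
    using spin_lift_linear(3)[OF g, of "s1 - s"] linear_diff[OF spin_lift_linear(1)[OF g], of s1 s]
    by (simp add: dist_norm)
  moreover have "dist v2 (v + v2 - v1) = dist v1 v" by (simp add: dist_norm)
  ultimately have "dist q (v + v2 - v1, s'') \<le> dist p a"
    using s''(2) by (simp add: pq dist_Pair_Pair power_mono)
  moreover have "hopf_map s = \<Psi> v *v leaf_map a" using leaf_map_eq_iff[of a "leaf_map a"] pq by simp
  then have "leaf_map (v + v2 - v1, s'') = leaf_map a"
    by (simp add: leaf_map_eq_iff s''(1) hg shift)
  ultimately show ?thesis by blast
qed

lemma equidistant_leaves:
  assumes "leaf_map p = leaf_map q" shows "infdist p (leaf_map -` {w}) = infdist q (leaf_map -` {w})"
proof -
  have le: "infdist q (leaf_map -` {w}) \<le> infdist p (leaf_map -` {w})" if pq: "leaf_map p = leaf_map q" for p q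
  proof -
    have ne: "leaf_map -` {w} \<noteq> {}" using fst_leaf[of w] by blast
    show ?thesis
      unfolding infdist_notempty[OF ne]
    proof (rule cINF_mono[OF ne])
      show "bdd_below (dist q ` (leaf_map -` {w}))" by (rule bdd_belowI[of _ 0]) auto
      show "\<exists>b\<in>leaf_map -` {w}. dist q b \<le> dist p a" if "a \<in> leaf_map -` {w}" for a
        using leaf_transport[OF pq, of a] that by auto
    qed
  qed
  show ?thesis using le[of p q] le[of q p] assms by simp
qed

text \<open>The image of \<open>\<xi>\<close> under the differential of \<open>\<Psi>\<close> at \<open>0\<close>.\<close>
definition generator :: "'b \<Rightarrow> real ^ 9 ^ 9"
  where "generator \<xi> = vector_derivative (\<lambda>t. \<Psi> (t *\<^sub>R \<xi>)) (at 0)"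

lemma generator: "((\<lambda>t. \<Psi> (t *\<^sub>R \<xi>)) has_vector_derivative generator \<xi>) (at 0)"
proof -
  have "Ck_on (Suc 0) UNIV (\<lambda>t::real. \<Psi> (t *\<^sub>R \<xi>))"
    by (intro Ck_on_A Ck_intros open_UNIV)
  then have "(\<lambda>t::real. \<Psi> (t *\<^sub>R \<xi>)) differentiable at 0" by simp
  then show ?thesis unfolding generator_def by (simp add: vector_derivative_works)
qed

lemma generator_skew: "generator \<xi> $ j $ i = - generator \<xi> $ i $ j"
proof -
  let ?M = "\<lambda>t. \<Psi> (t *\<^sub>R \<xi>)" and ?B = "generator \<xi>"
  have d: "((\<lambda>t. ?M t *v axis k 1) has_vector_derivative ?B *v axis k 1) (at 0)" for k
    by (rule bounded_linear.has_vector_derivative[OF bounded_bilinear.bounded_linear_left[OF bounded_bilinear_matrix_vector_mult] generator])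
  have "((\<lambda>t. (?M t *v axis i 1) \<bullet> (?M t *v axis j 1)) has_vector_derivative
      ((?M 0 *v axis i 1) \<bullet> (?B *v axis j 1) + (?B *v axis i 1) \<bullet> (?M 0 *v axis j 1))) (at 0)"
    by (rule bounded_bilinear.has_vector_derivative[OF bounded_bilinear_inner d d])
  moreover have "((\<lambda>t. (?M t *v axis i 1) \<bullet> (?M t *v axis j 1)) has_vector_derivative 0) (at 0)"
    by (simp add: orthogonal_matrix_inner[OF orth])
  ultimately have "(?M 0 *v axis i 1) \<bullet> (?B *v axis j 1) + (?B *v axis i 1) \<bullet> (?M 0 *v axis j 1) = 0"
    using vector_derivative_unique_at by blast
  then show ?thesis
    by (simp only: scaleR_zero_left twist_zero matrix_vector_mul_lid inner_axis inner_axis')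
      (simp add: matrix_vector_mult_basis column_def)
qed

text \<open>Along the line through \<open>(v, s)\<close> in this direction \<open>H = \<Psi>(v)\<^sup>T \<Psi>(t \<xi>)\<^sup>T h(s + t \<beta> s)\<close>, and the contributions
  \<open>B\<^sup>T h(s) = - B h(s)\<close> and \<open>B h(s)\<close> of the two factors that depend on \<open>t\<close> cancel.\<close>
lemma generator_field_kernel:
  "frechet_derivative leaf_map (at (v, s)) (\<xi>, spin_generator (generator \<xi>) s) = 0"
proof -
  let ?B = "generator \<xi>"
  let ?\<eta> = "spin_generator ?B s"
  define \<gamma> where "\<gamma> t = (v + t *\<^sub>R \<xi>, s + t *\<^sub>R ?\<eta>)" for t :: real
  let ?D = "frechet_derivative leaf_map (at (v, s))"
  have d\<gamma>: "(\<gamma> has_vector_derivative (\<xi>, ?\<eta>)) (at 0)"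
    unfolding \<gamma>_def by (intro has_vector_derivative_Pair) (auto intro!: derivative_eq_intros)
  have "((\<lambda>t. leaf_map (\<gamma> t)) has_derivative (\<lambda>t. ?D (t *\<^sub>R (\<xi>, ?\<eta>)))) (at 0)"
    using diff_chain_at[OF d\<gamma>[unfolded has_vector_derivative_def], of leaf_map ?D] leaf_map_has_derivative[of "(v, s)"]
    by (simp add: o_def \<gamma>_def)
  then have 1: "((\<lambda>t. leaf_map (\<gamma> t)) has_vector_derivative ?D (\<xi>, ?\<eta>)) (at 0)"
    unfolding has_vector_derivative_def
    by (simp only: linear_scale[OF has_derivative_linear[OF leaf_map_has_derivative]])
  have dl: "((\<lambda>t. s + t *\<^sub>R ?\<eta>) has_vector_derivative ?\<eta>) (at 0)"
    by (auto intro!: derivative_eq_intros)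
  have dh: "((\<lambda>t. hopf_map (s + t *\<^sub>R ?\<eta>)) has_vector_derivative 2 *\<^sub>R hopf_polar s ?\<eta>) (at 0)"
    unfolding hopf_map_polar
    using bounded_bilinear.has_vector_derivative[OF bounded_bilinear_hopf_polar dl dl]
    by (simp add: hopf_polar_commute[of ?\<eta> s] scaleR_2)
  have dM: "((\<lambda>t. transpose (\<Psi> (t *\<^sub>R \<xi>))) has_vector_derivative transpose ?B) (at 0)"
    by (rule bounded_linear.has_vector_derivative[OF bounded_linear_transpose generator])
  have "(transpose ?B *v x) \<bullet> axis i 1 = (- (?B *v x)) \<bullet> axis i 1" for x i
    by (simp add: inner_axis matrix_vector_mult_def transpose_def sum_negf[symmetric] del: transpose_matrix_vector)
      (intro sum.cong refl, simp add: generator_skew[of \<xi> i])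
  then have tB: "transpose ?B *v hopf_map s = - (?B *v hopf_map s)"
    by (simp add: vec_eq_iff inner_axis del: transpose_matrix_vector)
  then have "((\<lambda>t. transpose (\<Psi> (t *\<^sub>R \<xi>)) *v hopf_map (s + t *\<^sub>R ?\<eta>)) has_vector_derivative 0) (at 0)"
    using bounded_bilinear.has_vector_derivative[OF bounded_bilinear_matrix_vector_mult dM dh]
    by (simp add: twist_zero transpose_mat hopf_polar_spin_generator[OF generator_skew])
  then have "((\<lambda>t. transpose (\<Psi> v) *v (transpose (\<Psi> (t *\<^sub>R \<xi>)) *v hopf_map (s + t *\<^sub>R ?\<eta>)))
      has_vector_derivative transpose (\<Psi> v) *v 0) (at 0)"
    by (rule bounded_linear.has_vector_derivative[OF bounded_bilinear.bounded_linear_right[OF bounded_bilinear_matrix_vector_mult]])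
  moreover have "transpose (\<Psi> v) *v (transpose (\<Psi> (t *\<^sub>R \<xi>)) *v x) = transpose (\<Psi> (v + t *\<^sub>R \<xi>)) *v x" for t x
    using add[of "t *\<^sub>R \<xi>" v] unfolding matrix_vector_mul_assoc matrix_transpose_mul[symmetric]
    by (simp add: add.commute)
  ultimately have "((\<lambda>t. leaf_map (\<gamma> t)) has_vector_derivative transpose (\<Psi> v) *v 0) (at 0)"
    by (simp add: leaf_map_def \<gamma>_def)
  then have "frechet_derivative leaf_map (at (v, s)) (\<xi>, ?\<eta>) = transpose (\<Psi> v) *v 0"
    using 1 vector_derivative_unique_at by blast
  then show ?thesis by simp
qed

text \<open>A tangent vector of the leaf \<open>s = 0\<close> has the form \<open>(\<xi>, 0)\<close>. The field \<open>(\<xi>, \<beta> s)\<close> lies in the kernel of the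
  differential of \<open>H\<close> everywhere, which gives tangency where \<open>s \<noteq> 0\<close>; on \<open>s = 0\<close> it is
  constant and tangent along straight lines.\<close>
lemma tangent_field_singular:
  assumes p: "snd p = 0" and x: "x \<in> tangent_vectors (leaf_map -` {leaf_map p}) p"
  shows "\<exists>U X. open U \<and> p \<in> U \<and> smooth_on U X \<and> X p = x \<and>
    (\<forall>q\<in>U. X q \<in> tangent_vectors (leaf_map -` {leaf_map q}) q)"
proof -
  have t0: "leaf_map q = 0 \<longleftrightarrow> snd q = 0" for q
    using norm_leaf_map[of q] by (metis norm_eq_zero power_eq_0_iff zero_power2)
  have "leaf_map -` {leaf_map p} = snd -` {0}"
    by (rule Set.set_eqI) (simp add: t0 t0[THEN iffD2, OF p])
  then have sx: "snd x = 0"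
    using tangent_vector_derivative_zero[of x snd 0 p snd] x has_derivative_snd[OF has_derivative_ident] by auto
  define \<xi> where "\<xi> = fst x"
  define X where "X q = (\<xi>, spin_generator (generator \<xi>) (snd q))" for q :: "'b \<times> (octonion \<times> octonion)"
  have sg0: "spin_generator B 0 = 0" for B
    using bounded_linear.linear[OF bounded_linear_spin_generator] linear_0 by blast
  have "Ck_on n UNIV X" for n
    unfolding X_def by (intro Ck_intros open_UNIV Ck_on_linear_comp[OF _ bounded_linear_spin_generator])
  then have "smooth_on UNIV X" by (simp add: smooth_on_open_iff)
  moreover have "X p = x" by (rule prod_eqI) (simp_all add: X_def \<xi>_def sg0 p sx)
  moreover have "X q \<in> tangent_vectors (leaf_map -` {leaf_map q}) q" for q
  proof (cases "snd q = 0")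
    case False
    show ?thesis
      by (rule kernel_imp_tangent[OF False leaf_map_has_derivative])
        (use generator_field_kernel[of "fst q" "snd q" \<xi>] in \<open>simp add: X_def\<close>)
  next
    case True
    define \<gamma> where "\<gamma> t = (fst q + t *\<^sub>R \<xi>, 0 :: octonion \<times> octonion)" for t :: real
    have "Ck_on n {-1<..<1} \<gamma>" for n unfolding \<gamma>_def by (intro Ck_intros open_greaterThanLessThan)
    then have "smooth_on {-1<..<1} \<gamma>" by (simp add: smooth_on_open_iff)
    moreover have "(\<gamma> has_vector_derivative (\<xi>, 0)) (at 0)"
      unfolding \<gamma>_def by (intro has_vector_derivative_Pair) (auto intro!: derivative_eq_intros)
    moreover have "\<gamma> ` {-1<..<1} \<subseteq> leaf_map -` {leaf_map q}"
    proof (rule image_subsetI)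
      fix t
      show "\<gamma> t \<in> leaf_map -` {leaf_map q}"
        using t0[of "\<gamma> t"] t0[of q] True by (simp add: \<gamma>_def)
    qed
    moreover have "\<gamma> 0 = q" using True by (simp add: \<gamma>_def prod_eq_iff)
    ultimately show ?thesis
      unfolding tangent_vectors_def X_def True sg0 using zero_less_one by blast
  qed
  ultimately show ?thesis by blast
qed

lemma equidistant_foliation_leaves: "equidistant_foliation leaves"
  unfolding equidistant_foliation_def
proof (intro conjI ballI)
  show "partition_on UNIV leaves"
  proof (rule partition_onI)
    have "leaf_map -` {w} \<noteq> {}" for w using fst_leaf[of w] by blast
    then show "{} \<notin> leaves" unfolding leaves_def by blast
  qed (auto simp: leaves_def disjnt_def)
next
  fix L assume "L \<in> leaves"
  then obtain w where L: "L = leaf_map -` {w}" unfolding leaves_def by blast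
  show emb: "\<exists>d. embedded_submanifold d L" unfolding L by (rule embedded_leaf)
  then show "complete_submanifold L"
    using closed_embedded_imp_complete closed_leaf L by blast
  show "connected L" unfolding L by (rule connected_leaf)
  show "properly_embedded L"
    unfolding properly_embedded_def L using closed_leaf closed_Int_compact by blast
next
  fix F G p q assume "F \<in> leaves" "G \<in> leaves" "p \<in> F" "q \<in> F"
  then show "infdist p G = infdist q G"
    using equidistant_leaves[of p q] unfolding leaves_def by auto
next
  fix F p x assume F: "F \<in> leaves" "p \<in> F" "x \<in> tangent_vectors F p"
  have leaf: "L = leaf_map -` {leaf_map q}" if "L \<in> leaves" "q \<in> L" for L q
    using that unfolding leaves_def by auto
  have "x \<in> tangent_vectors (leaf_map -` {leaf_map p}) p" using F leaf by blast
  then obtain U X where "open U" "p \<in> U" "smooth_on U X" "X p = x"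
    "\<forall>q\<in>U. X q \<in> tangent_vectors (leaf_map -` {leaf_map q}) q"
    using tangent_field_regular tangent_field_singular by metis
  then show "\<exists>U X. open U \<and> p \<in> U \<and> smooth_on U X \<and> X p = x \<and>
       (\<forall>L\<in>leaves. \<forall>q\<in>U \<inter> L. X q \<in> tangent_vectors L q)"
    using leaf by (intro exI[of _ U] exI[of _ X] conjI ballI) (simp_all, metis)
qed

end

theorem proposition5p3:
  fixes \<Psi> :: "real ^ 'k::finite \<Rightarrow> real ^ 9 ^ 9"
  assumes "lie_group_hom vector_group SO9 \<Psi>"
  shows "equidistant_foliation (range (twisted_leaf \<Psi>)) \<and>
    noncompact_foliation (range (twisted_leaf \<Psi>)) \<and>
    \<not> homogeneous_foliation TYPE('g::euclidean_space) (range (twisted_leaf \<Psi>)) \<and>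
    (\<forall>v. induced_foliation (range (twisted_leaf \<Psi>)) v = hopf_foliation)"
proof -
  have hom: "\<Psi> \<in> hom vector_group SO9" and sm: "smooth_on UNIV \<Psi>"
    using assms by (auto simp: lie_group_hom_def vector_group_def)
  interpret hopf_twist \<Psi>
  proof
    show "rotation_matrix (\<Psi> v)" for v
      using hom by (auto simp: hom_def vector_group_def SO9_def)
    show "\<Psi> (v + w) = \<Psi> v ** \<Psi> w" for v w
      using hom by (auto simp: hom_def vector_group_def SO9_def)
    show "Ck_on n UNIV \<Psi>" for n
      using sm by (simp add: smooth_on_open_iff)
  qed
  have leaf: "twisted_leaf \<Psi> x = leaf_map -` {hopf_map x}" for x
    unfolding twisted_leaf_def leaf_through_hopf SO9_act_fibre[OF rot]
    by (auto simp: leaf_map_eq_iff)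
  have leaves: "range (twisted_leaf \<Psi>) = leaves"
  proof -
    have "range hopf_map = UNIV" by (metis surj_def surj_hopf_map)
    then have "(\<lambda>w. leaf_map -` {w}) ` range hopf_map = leaves" unfolding leaves_def by simp
    moreover have "twisted_leaf \<Psi> = (\<lambda>x. leaf_map -` {hopf_map x})" using leaf by blast
    ultimately show ?thesis by (simp only: image_image)
  qed
  have "induced_foliation leaves v = hopf_foliation" for v
  proof -
    have "induced_foliation leaves v = range (\<lambda>w. hopf_map -` {\<Psi> v *v w})"
      unfolding induced_foliation_def leaves_def image_image by (simp add: leaf_map_eq_iff vimage_def)
    also have "\<dots> = (\<lambda>w. hopf_map -` {w}) ` range ((*v) (\<Psi> v))" by (simp add: image_image)
    also have "range ((*v) (\<Psi> v)) = UNIV" by (metis A_transpose(1) surj_def)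
    finally show ?thesis by (simp add: hopf_foliation_eq)
  qed
  moreover have "noncompact_foliation leaves"
    unfolding noncompact_foliation_def leaves_def using not_compact_leaf by blast
  ultimately show ?thesis
    unfolding leaves using equidistant_foliation_leaves inhomogeneous by blast
qed

end
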